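(* Let $G=(V,E)$ be a digraph such that there exists a positive integer $N$ satisfying $\Omega_n(G)=0$ for every integer $n\ge N+1$. Then for every non-vanishing function $f:V\to\mathbb{R}\setminus\{0\}$ and every real number $c\ne 0$, $$T(G)=T(G,f,f)=t(G,c)\,T(G,cf,f)=t(G,c)^{-1}\,T(G,f,cf),$$ where $t(G,c)=|c|^{s(G)}$ and $s(G)=\sum_{n\ge 0}(-1)^n\dim\partial_n\Omega_n(G)$.
   Context: A digraph $G=(V,E)$ consists of a finite set $V$ and a subset $E\subseteq\{(u,v)\in V\times V: u\ne v\}$. Paths. For $n\ge 0$, an elementary $n$-path on $V$ is a sequence $v_0v_1\ldots v_n$ of elements of $V$ (repetitions allowed); $\Lambda_n(V)$ is the real vector space with basis the elementary $n$-paths, and $\Lambda_{-1}(V)=0$. An elementary path is regular if $v_{i-1}\ne v_i$ for all $1\le i\le n$, irregular otherwise; $I_n(V)\subseteq\Lambda_n(V)$ is the span of the irregular elementary $n$-paths and $\mathcal{R}_n(V)=\Lambda_n(V)/I_n(V)$, which has as basis the (classes of) regular elementary $n$-paths; $\mathcal R_{-1}(V)=0$. Weighted boundary. For $f:V\to\mathbb{R}\setminus\{0\}$, let $\partial_n^f:\Lambda_n(V)\to\Lambda_{n-1}(V)$ be the linear map with $\partial^f_n(v_0\ldots v_n)=\sum_{i=0}^n(-1)^i f(v_i)\,v_0\ldots\widehat{v_i}\ldots v_n$ for $n\ge1$, and $\partial_0^f=0$. It induces $\partial_n^f:\mathcal{R}_n(V)\to\mathcal{R}_{n-1}(V)$ with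 $\partial^f_{n}\partial^f_{n+1}=0$. Write $\partial_n=\partial_n^1$ for the constant weight $1$. Weighted inner product. For $g:V\to\mathbb{R}\setminus\{0\}$, $\langle\,,\rangle_g$ is the bilinear inner product on $\mathcal{R}_n(V)$ given on regular elementary paths by $\langle v_0\ldots v_n,u_0\ldots u_n\rangle_g=\prod_{i=0}^n g(v_i)g(u_i)\delta(v_i,u_i)$, where $\delta(v,u)=1$ if $v=u$ and $0$ otherwise. Weighted path complex. $\mathcal{A}_n(G)\subseteq\mathcal{R}_n(V)$ is the span of the elementary $n$-paths $v_0\ldots v_n$ with $(v_{i-1},v_i)\in E$ for all $1\le i\le n$ (and $\mathcal A_{-1}(G)=0$). Put $\Omega_n^{f,g}(G)=\mathcal{A}_n(G)\cap(\partial_n^f)^{-1}(\mathcal{A}_{n-1}(G))$, a chain complex with boundary $\partial^f_n$, endowed with the restriction of the inner product $\langle\,,\rangle_g$. The unweighted complex is $\Omega_n(G)=\mathcal{A}_n(G)\cap\partial_n^{-1}(\mathcal{A}_{n-1}(G))$ with boundary $\partial_n$. Weighted Laplacian and torsion. Let $\Delta_n^{f,g}(G)=(\partial_n^f|_{\Omega_n^{f,g}(G)})^*(\partial_n^f|_{\Omega_n^{f,g}(G)})+(\partial_{n+1}^f|_{\Omega_{n+1}^{f,g}(G)})(\partial_{n+1}^f|_{\Omega_{n+1}^{f,g}(G)})^*$ on $\Omega_n^{f,g}(G)$, where $*$ denotes the adjoint of a map $\Omega_k^{f,g}(G)\to\Omega_{k-1}^{f,g}(G)$ with respect to $\langle\,,\rangle_g$.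 With $\lambda_i$ the eigenvalues of $\Delta_n^{f,g}(G)$ counted with multiplicity, set $\zeta_n^{f,g}(s)=\sum_{\lambda_i>0}\lambda_i^{-s}$. If $\Omega_n(G)=0$ for all $n\ge N+1$ (equivalently $\Omega^{f,g}_n(G)=0$ for all $n\ge N+1$), $T(G,f,g)>0$ is defined by $\log T(G,f,g)=\frac12\sum_{n=0}^N(-1)^n n\,\frac{d}{ds}\big|_{s=0}\zeta_n^{f,g}(s)$. The (unweighted) analytic torsion $T(G)$ is defined in the same way from the complex $\Omega_*(G)$ with boundary $\partial_n$ and the standard inner product $\langle u,v\rangle=\sum_i u^iv^i$ for $u=\sum_i u^ie_i$, $v=\sum_i v^ie_i$ with $e_i$ the allowed elementary $n$-paths; that is, $T(G)=T(G,1,1)$. The weight $cf$ takes the value $cf(v)$ at $v\in V$. *)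

theory Defs
  imports
    "HOL-Analysis.Analysis"
    "HOL-Analysis.Finite_Function_Topology"
    "Graph_Theory.Pair_Digraph"
begin

text \<open>
  An elementary path \<open>v\<^sub>0 v\<^sub>1 \<dots> v\<^sub>n\<close> is the list of its vertices, and a real linear combination
  of elementary paths is a finitely supported function \<^typ>\<open>'a list \<Rightarrow>\<^sub>0 real\<close>. Degrees are
  integers, so that the spaces in degree \<open>-1\<close> vanish without special treatment.
\<close>

definition elementary_paths :: "'a set \<Rightarrow> int \<Rightarrow> 'a list set" where
  "elementary_paths V n = {p. p \<noteq> [] \<and> int (length p) = n + 1 \<and> set p \<subseteq> V}"

definition allowed_paths :: "'a pair_pre_digraph \<Rightarrow> int \<Rightarrow> 'a list set" where
  "allowed_paths G n =
    {p \<in> elementary_paths (pverts G) n. successively (\<lambda>u v. (u, v) \<in> parcs G) p}"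

definition delete_nth :: "nat \<Rightarrow> 'a list \<Rightarrow> 'a list" where
  "delete_nth i p = take i p @ drop (Suc i) p"

text \<open>The boundary on the space \<open>\<Lambda>\<^sub>n(V)\<close> of all elementary paths, with \<open>\<partial>\<^sub>0 = 0\<close>.\<close>

definition elementary_boundary :: "('a \<Rightarrow> real) \<Rightarrow> 'a list \<Rightarrow> 'a list \<Rightarrow>\<^sub>0 real" where
  "elementary_boundary f p =
    (if length p \<le> 1 then 0
     else \<Sum>i<length p. Poly_Mapping.single (delete_nth i p) ((-1) ^ i * f (p ! i)))"

definition full_boundary :: "('a \<Rightarrow> real) \<Rightarrow> ('a list \<Rightarrow>\<^sub>0 real) \<Rightarrow> 'a list \<Rightarrow>\<^sub>0 real" where
  "full_boundary f c = (\<Sum>p\<in>Poly_Mapping.keys c. Poly_Mapping.lookup c p *\<^sub>R elementary_boundary f p)"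

text \<open>
  A class in \<open>\<R>\<^sub>n(V) = \<Lambda>\<^sub>n(V) / I\<^sub>n(V)\<close> is represented by its unique representative supported on
  regular paths; \<open>regular_part\<close> is the quotient map. The lemma \<open>path_boundary_regular_part\<close> below
  states that the boundary on \<open>\<Lambda>\<close> descends to the quotient.
\<close>

definition regular_part :: "('a list \<Rightarrow>\<^sub>0 real) \<Rightarrow> 'a list \<Rightarrow>\<^sub>0 real" where
  "regular_part c =
    (\<Sum>p\<in>{p \<in> Poly_Mapping.keys c. distinct_adj p}. Poly_Mapping.single p (Poly_Mapping.lookup c p))"

definition path_boundary :: "('a \<Rightarrow> real) \<Rightarrow> ('a list \<Rightarrow>\<^sub>0 real) \<Rightarrow> 'a list \<Rightarrow>\<^sub>0 real" where
  "path_boundary f c = regular_part (full_boundary f c)"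

lemma lookup_regular_part:
  "Poly_Mapping.lookup (regular_part c) q = (if distinct_adj q then Poly_Mapping.lookup c q else 0)"
proof -
  have "Poly_Mapping.lookup (regular_part c) q =
      (\<Sum>p\<in>{p \<in> Poly_Mapping.keys c. distinct_adj p}. if p = q then Poly_Mapping.lookup c p else 0)"
    unfolding regular_part_def lookup_sum
    by (rule sum.cong) (auto simp: lookup_single when_def)
  then show ?thesis
    by (auto simp: sum.delta' in_keys_iff)
qed

lemma lookup_scaleR:
  "Poly_Mapping.lookup (r *\<^sub>R c) p = r *\<^sub>R Poly_Mapping.lookup (c :: 'b \<Rightarrow>\<^sub>0 'c::real_vector) p"
proof -
  have "finite {p. r *\<^sub>R Poly_Mapping.lookup c p \<noteq> 0}"
    by (rule finite_subset[OF _ finite_keys[of c]]) (auto simp: in_keys_iff)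
  then show ?thesis
    by (simp add: scaleR_poly_mapping_def)
qed

lemma length_delete_nth: "i < length p \<Longrightarrow> length (delete_nth i p) = length p - 1"
  by (simp add: delete_nth_def)

lemma nth_delete_nth:
  "i < length p \<Longrightarrow> j < length p - 1 \<Longrightarrow>
    delete_nth i p ! j = (if j < i then p ! j else p ! Suc j)"
  by (simp add: delete_nth_def nth_append min_def)

lemma distinct_adj_delete_nth:
  assumes "Suc k < length p" "p ! k = p ! Suc k" "i < length p" "i \<noteq> k" "i \<noteq> Suc k"
  shows "\<not> distinct_adj (delete_nth i p)"
proof -
  define j where "j = (if i < k then k - 1 else k)"
  have "Suc j < length (delete_nth i p)" "delete_nth i p ! j = delete_nth i p ! Suc j"
    using assms by (auto simp: j_def length_delete_nth nth_delete_nth)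
  then show ?thesis
    using distinct_adj_nth by blast
qed

lemma regular_part_elementary_boundary:
  assumes "\<not> distinct_adj p"
  shows "regular_part (elementary_boundary f p) = 0"
proof (rule poly_mapping_eqI)
  fix q
  obtain k where k: "Suc k < length p" "p ! k = p ! Suc k"
    using assms by (auto simp: distinct_adj_conv_nth)
  have "Poly_Mapping.lookup (elementary_boundary f p) q = 0" if q: "distinct_adj q"
  proof -
    define h where "h i = ((-1) ^ i * f (p ! i) when delete_nth i p = q)" for i
    have same: "delete_nth k p = delete_nth (Suc k) p"
    proof -
      have "drop (Suc k) p = p ! Suc k # drop (Suc (Suc k)) p"
        using k by (simp add: Cons_nth_drop_Suc)
      then show ?thesis
        using k by (simp add: delete_nth_def take_Suc_conv_app_nth)
    qed
    have "Poly_Mapping.lookup (elementary_boundary f p) q = (\<Sum>i<length p. h i)"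
      using k by (simp add: elementary_boundary_def lookup_sum lookup_single h_def)
    also have "\<dots> = (\<Sum>i\<in>{k, Suc k}. h i)"
      by (rule sum.mono_neutral_right)
        (use k q distinct_adj_delete_nth[OF k] in \<open>auto simp: h_def when_def\<close>)
    also have "\<dots> = 0"
      using k same by (simp add: h_def when_def)
    finally show ?thesis .
  qed
  then show "Poly_Mapping.lookup (regular_part (elementary_boundary f p)) q = Poly_Mapping.lookup 0 q"
    by (simp add: lookup_regular_part)
qed

lemma path_boundary_regular_part: "path_boundary f (regular_part c) = path_boundary f c"
proof (rule poly_mapping_eqI)
  fix q
  have keys: "Poly_Mapping.keys (regular_part c) = {p \<in> Poly_Mapping.keys c. distinct_adj p}"
    by (auto simp: in_keys_iff lookup_regular_part split: if_splits)
  have irr: "Poly_Mapping.lookup (elementary_boundary f p) q = 0"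
    if "\<not> distinct_adj p" "distinct_adj q" for p
    using regular_part_elementary_boundary[OF that(1), of f] lookup_regular_part[of "elementary_boundary f p" q] that(2)
    by simp
  have "Poly_Mapping.lookup (full_boundary f (regular_part c)) q = Poly_Mapping.lookup (full_boundary f c) q"
    if "distinct_adj q"
    unfolding full_boundary_def keys lookup_sum lookup_scaleR
    by (rule sum.mono_neutral_cong_left) (use that irr in \<open>auto simp: lookup_regular_part\<close>)
  then show "Poly_Mapping.lookup (path_boundary f (regular_part c)) q =
      Poly_Mapping.lookup (path_boundary f c) q"
    by (simp add: path_boundary_def lookup_regular_part)
qed

text \<open>Only meaningful for paths, and hence chains, of the same degree.\<close>

definition elementary_inner :: "('a \<Rightarrow> real) \<Rightarrow> 'a list \<Rightarrow> 'a list \<Rightarrow> real" where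
  "elementary_inner g p q = (\<Prod>i<length p. g (p ! i) * g (q ! i) * of_bool (p ! i = q ! i))"

definition weighted_inner :: "('a \<Rightarrow> real) \<Rightarrow> ('a list \<Rightarrow>\<^sub>0 real) \<Rightarrow> ('a list \<Rightarrow>\<^sub>0 real) \<Rightarrow> real" where
  "weighted_inner g x y =
    (\<Sum>p\<in>Poly_Mapping.keys x. \<Sum>q\<in>Poly_Mapping.keys y.
      Poly_Mapping.lookup x p * Poly_Mapping.lookup y q * elementary_inner g p q)"

definition allowed_chains :: "'a pair_pre_digraph \<Rightarrow> int \<Rightarrow> ('a list \<Rightarrow>\<^sub>0 real) set" where
  "allowed_chains G n = span ((\<lambda>p. Poly_Mapping.single p 1) ` allowed_paths G n)"

definition Omega :: "'a pair_pre_digraph \<Rightarrow> ('a \<Rightarrow> real) \<Rightarrow> int \<Rightarrow> ('a list \<Rightarrow>\<^sub>0 real) set" where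
  "Omega G f n = {c \<in> allowed_chains G n. path_boundary f c \<in> allowed_chains G (n - 1)}"

text \<open>The adjoint of \<open>\<partial>\<^sub>n\<^sup>f : \<Omega>\<^sub>n \<rightarrow> \<Omega>\<^sub>n\<^sub>-\<^sub>1\<close>, evaluated at \<open>y \<in> \<Omega>\<^sub>n\<^sub>-\<^sub>1\<close>.\<close>

definition boundary_adjoint ::
  "'a pair_pre_digraph \<Rightarrow> ('a \<Rightarrow> real) \<Rightarrow> ('a \<Rightarrow> real) \<Rightarrow> int \<Rightarrow> ('a list \<Rightarrow>\<^sub>0 real) \<Rightarrow> 'a list \<Rightarrow>\<^sub>0 real" where
  "boundary_adjoint G f g n y =
    (THE x. x \<in> Omega G f n \<and>
      (\<forall>u \<in> Omega G f n. weighted_inner g (path_boundary f u) y = weighted_inner g u x))"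

definition path_Laplacian ::
  "'a pair_pre_digraph \<Rightarrow> ('a \<Rightarrow> real) \<Rightarrow> ('a \<Rightarrow> real) \<Rightarrow> int \<Rightarrow> ('a list \<Rightarrow>\<^sub>0 real) \<Rightarrow> 'a list \<Rightarrow>\<^sub>0 real" where
  "path_Laplacian G f g n c =
    boundary_adjoint G f g n (path_boundary f c) +
    path_boundary f (boundary_adjoint G f g (n + 1) c)"

definition Laplacian_eigenspace ::
  "'a pair_pre_digraph \<Rightarrow> ('a \<Rightarrow> real) \<Rightarrow> ('a \<Rightarrow> real) \<Rightarrow> int \<Rightarrow> real \<Rightarrow> ('a list \<Rightarrow>\<^sub>0 real) set" where
  "Laplacian_eigenspace G f g n \<mu> = {c \<in> Omega G f n. path_Laplacian G f g n c = \<mu> *\<^sub>R c}"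

text \<open>
  The Laplacian is self-adjoint, so the multiplicity of an eigenvalue is the dimension of its
  eigenspace.
\<close>

definition path_zeta ::
  "'a pair_pre_digraph \<Rightarrow> ('a \<Rightarrow> real) \<Rightarrow> ('a \<Rightarrow> real) \<Rightarrow> int \<Rightarrow> real \<Rightarrow> real" where
  "path_zeta G f g n s =
    (\<Sum>\<mu>\<in>{\<mu>. \<mu> > 0 \<and> Laplacian_eigenspace G f g n \<mu> \<noteq> {0}}.
      real (dim (Laplacian_eigenspace G f g n \<mu>)) * \<mu> powr (- s))"

text \<open>\<open>N\<close> is any bound such that the complex vanishes in all degrees above \<open>N\<close>.\<close>

definition torsion ::
  "'a pair_pre_digraph \<Rightarrow> nat \<Rightarrow> ('a \<Rightarrow> real) \<Rightarrow> ('a \<Rightarrow> real) \<Rightarrow> real" where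
  "torsion G N f g =
    exp (1 / 2 * (\<Sum>n = 0..N. (-1) ^ n * real n * deriv (path_zeta G f g (int n)) 0))"

definition torsion_exponent :: "'a pair_pre_digraph \<Rightarrow> int" where
  "torsion_exponent G =
    Sum_any (\<lambda>n::nat. (-1) ^ n * int (dim (path_boundary (\<lambda>_. 1) ` Omega G (\<lambda>_. 1) (int n))))"

definition torsion_factor :: "'a pair_pre_digraph \<Rightarrow> real \<Rightarrow> real" where
  "torsion_factor G c = \<bar>c\<bar> powi torsion_exponent G"

end

theory Submission
  imports Defs
begin

text \<open>
  Dividing each path by the product of \<open>f\<close> over its vertices is an isomorphism from the unweighted
  complex to the one of weight \<open>a f\<close>, up to a factor \<open>a\<close> in the boundary; from the standard inner
  product to that of weight \<open>b f\<close> it changes lengths by the factor \<open>\<bar>b\<bar> ^ (n + 1)\<close> in degree \<open>n\<close>. It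
  therefore conjugates the Laplacian of weights \<open>(a f, b f)\<close> to \<open>a\<^sup>2 / b\<^sup>2\<close> times the unweighted one, and
  \<open>\<zeta>'(0)\<close> changes by \<open>- ln (a\<^sup>2 / b\<^sup>2)\<close> times the number of positive eigenvalues. By the spectral theorem
  and the Hodge decomposition this number is \<open>dim \<partial>\<Omega>\<^sub>n + dim \<partial>\<Omega>\<^sub>n\<^sub>+\<^sub>1\<close>, and its alternating sum weighted
  by \<open>n\<close> telescopes to \<open>s(G)\<close>. The three equalities are the cases \<open>(a, b) = (1, 1), (c, 1), (1, c)\<close>.
\<close>

section \<open>Symmetric operators on finite-dimensional spaces\<close>

text \<open>The type of chains is infinite-dimensional, so finite dimension has to be a property of
  individual subspaces.\<close>

definition fin_subspace :: "'v::real_vector set \<Rightarrow> bool" where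
  "fin_subspace S \<longleftrightarrow> (\<exists>B. finite B \<and> S = span B)"

lemma fin_subspace_subspace: "fin_subspace S \<Longrightarrow> subspace S"
  by (auto simp: fin_subspace_def)

text \<open>A maximal independent subset of \<open>T\<close> lies in the span of the finite set
  \<open>B\<close>, so the exchange bound makes it finite.\<close>

lemma fin_subspace_subset:
  assumes "subspace T" "T \<subseteq> S" "fin_subspace S"
  shows "fin_subspace T"
proof -
  obtain B where B: "finite B" "S = span B"
    using assms(3) unfolding fin_subspace_def by blast
  obtain C where C: "C \<subseteq> T" "independent C" "T \<subseteq> span C"
    by (rule maximal_independent_subset)
  have "finite C"
    using independent_span_bound[OF B(1) C(2)] C(1) assms(2) B(2) by blast
  moreover have "T = span C"
    using C assms(1) by (simp add: span_minimal subset_antisym)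
  ultimately show ?thesis
    by (auto simp: fin_subspace_def)
qed

lemma fin_subspace_image: "linear f \<Longrightarrow> fin_subspace S \<Longrightarrow> fin_subspace (f ` S)"
  unfolding fin_subspace_def using linear_span_image finite_imageI by blast

lemma dim_zero: "dim {0 :: 'v::real_vector} = 0"
  using dim_span_eq_card_independent[OF independent_empty] by simp

text \<open>An injective linear map carries a basis to a basis of the same cardinality.\<close>

lemma dim_image_inj_on:
  fixes f :: "'v::real_vector \<Rightarrow> 'w::real_vector"
  assumes "linear f" "inj_on f (span S)"
  shows "dim (f ` S) = dim S"
proof -
  obtain B where B: "B \<subseteq> S" "independent B" "S \<subseteq> span B"
    by (rule maximal_independent_subset)
  have span: "span S = span B"
    using B by (simp add: span_eq span_mono span_superset subset_trans[OF B(1) span_superset])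
  have inj: "inj_on f (span B)"
    using assms(2) by (simp add: span)
  have "independent (f ` B)"
    using linear_independent_injective_image[OF assms(1) B(2) inj] .
  moreover have "span (f ` B) = span (f ` S)"
    by (simp add: linear_span_image[OF assms(1)] span)
  ultimately have "dim (f ` S) = card (f ` B)"
    by (intro dim_eq_card) auto
  also have "\<dots> = card B"
    using inj inj_on_subset[OF _ span_superset] by (intro card_image) blast
  also have "\<dots> = dim S"
    using dim_eq_card[OF _ B(2)] span by simp
  finally show ?thesis .
qed

text \<open>For small \<open>s\<close> the linear term dominates. This is the first-order condition
  at a maximum, applied below to the Rayleigh quotient.\<close>

lemma quadratic_nonpos_imp:
  fixes \<alpha> \<beta> :: real
  assumes "\<And>s. s * (2 * \<alpha>) + s\<^sup>2 * \<beta> \<le> 0"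
  shows "\<alpha> = 0"
proof -
  \<comment> \<open>With this \<open>s\<close> the hypothesis becomes \<open>s\<^sup>2\<close> times
    a positive number being at most 0, which forces \<open>s = 0\<close>.\<close>
  define s where "s = \<alpha> / (1 + \<bar>\<beta>\<bar>)"
  have \<alpha>: "\<alpha> = s * (1 + \<bar>\<beta>\<bar>)"
    by (simp add: s_def)
  then have "s\<^sup>2 * (2 * (1 + \<bar>\<beta>\<bar>) + \<beta>) \<le> 0"
    using assms[of s] by (simp add: algebra_simps power2_eq_square)
  moreover have "2 * (1 + \<bar>\<beta>\<bar>) + \<beta> > 0"
    using abs_ge_minus_self[of \<beta>] abs_ge_zero[of \<beta>] by (simp add: algebra_simps)
  ultimately show ?thesis
    using \<alpha> by (simp add: mult_le_0_iff)
qed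

text \<open>A bilinear form is used instead of the class \<^class>\<open>real_inner\<close>, because the norm which the
  library puts on \<^typ>\<open>'b \<Rightarrow>\<^sub>0 real\<close> is the \<open>L\<^sup>1\<close> norm.\<close>

locale inner_form =
  fixes ip :: "'v::real_vector \<Rightarrow> 'v \<Rightarrow> real"
  assumes add_left: "ip (x + y) z = ip x z + ip y z"
    and scale_left: "ip (r *\<^sub>R x) z = r * ip x z"
    and commute: "ip x y = ip y x"
    and pos: "x \<noteq> 0 \<Longrightarrow> ip x x > 0"
begin

lemma add_right: "ip z (x + y) = ip z x + ip z y"
  using add_left[of x y z] by (simp add: commute)

lemma scale_right: "ip z (r *\<^sub>R x) = r * ip z x"
  using scale_left[of r x z] by (simp add: commute)

lemma linear_left: "linear (\<lambda>x. ip x z)"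
  by (rule linearI) (simp_all add: add_left scale_left)

lemma linear_right: "linear (\<lambda>x. ip z x)"
  by (rule linearI) (simp_all add: add_right scale_right)

lemmas zero_left [simp] = linear_0[OF linear_left]
lemmas zero_right [simp] = linear_0[OF linear_right]
lemmas diff_left = linear_diff[OF linear_left]
lemmas diff_right = linear_diff[OF linear_right]
lemmas sum_left = linear_sum[OF linear_left]
lemmas sum_right = linear_sum[OF linear_right]

lemma eq_0_iff: "ip x x = 0 \<longleftrightarrow> x = 0"
  using pos[of x] by (cases "x = 0") auto

lemma nonneg: "ip x x \<ge> 0"
  using pos[of x] by (cases "x = 0") auto

text \<open>The difference \<open>x - y\<close> is itself a test vector, hence orthogonal to itself.
  Identities between vectors of \<open>W\<close> are proved below by testing against
  \<open>W\<close> in this way.\<close>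

lemma eqI:
  assumes "subspace W" "x \<in> W" "y \<in> W" "\<And>u. u \<in> W \<Longrightarrow> ip u x = ip u y"
  shows "x = y"
proof -
  have "ip (x - y) (x - y) = 0"
    using assms by (simp add: diff_right subspace_diff)
  then show ?thesis
    by (simp add: eq_0_iff)
qed

section \<open>Orthonormal bases, Riesz representation and orthogonal sums\<close>

definition orthonormal :: "'v set \<Rightarrow> bool" where
  "orthonormal C \<longleftrightarrow> (\<forall>b\<in>C. \<forall>b'\<in>C. ip b b' = of_bool (b = b'))"

lemma orthonormal_sum:
  assumes "orthonormal C" "finite C" "b \<in> C"
  shows "ip (\<Sum>c\<in>C. u c *\<^sub>R c) b = u b"
proof -
  have "ip (\<Sum>c\<in>C. u c *\<^sub>R c) b = (\<Sum>c\<in>C. if c = b then u c else 0)"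
    unfolding sum_left scale_left using assms by (intro sum.cong) (auto simp: orthonormal_def)
  then show ?thesis
    using assms by simp
qed

lemma orthonormal_expand:
  assumes "orthonormal C" "finite C" "x \<in> span C"
  shows "x = (\<Sum>c\<in>C. ip x c *\<^sub>R c)"
proof -
  obtain u where u: "x = (\<Sum>c\<in>C. u c *\<^sub>R c)"
    using assms span_finite by auto
  then have "ip x c = u c" if "c \<in> C" for c
    using orthonormal_sum[OF assms(1,2) that, of u] by simp
  then show ?thesis
    using u by (simp cong: sum.cong)
qed

lemma orthonormal_independent:
  assumes "orthonormal C"
  shows "independent C"
  unfolding independent_explicit_finite_subsets
proof (intro allI impI ballI)
  fix S u v
  assume S: "S \<subseteq> C" "finite S" "(\<Sum>v\<in>S. u v *\<^sub>R v) = 0" "v \<in> S"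
  then have "orthonormal S"
    using assms unfolding orthonormal_def by blast
  then show "u v = 0"
    using orthonormal_sum[of S v u] S by simp
qed

text \<open>One Gram-Schmidt step: subtract from \<open>x\<close> its components along
  \<open>C\<close> and normalise the residue \<open>y\<close>. If \<open>y = 0\<close>, then
  \<open>x\<close> already lies in \<open>span C\<close>.\<close>

lemma orthonormal_extend:
  assumes "orthonormal C" "finite C"
  shows "\<exists>D. orthonormal D \<and> finite D \<and> span D = span (insert x C)"
proof -
  define y where "y = x - (\<Sum>c\<in>C. ip x c *\<^sub>R c)"
  have mem: "(\<Sum>c\<in>C. ip x c *\<^sub>R c) \<in> span C"
    by (intro span_sum span_mul span_base)
  have perp: "ip y c = 0" if "c \<in> C" for c
    using orthonormal_sum[OF assms that, of "ip x"] by (simp add: y_def diff_left)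
  show ?thesis
  proof (cases "y = 0")
    case True
    then have "x \<in> span C"
      using mem by (simp add: y_def)
    then show ?thesis
      using assms span_redundant[of x C] by auto
  next
    case False
    define e where "e = (1 / sqrt (ip y y)) *\<^sub>R y"
    have ee: "ip e e = 1"
      using pos[OF False] by (simp add: e_def scale_left scale_right field_simps flip: power2_eq_square)
    have ec: "ip e c = 0" "ip c e = 0" if "c \<in> C" for c
      using perp[OF that] by (simp_all add: e_def scale_left scale_right commute[of c])
    have "e \<notin> C"
      using ee ec by force
    then have 1: "orthonormal (insert e C)"
      using assms(1) ee ec unfolding orthonormal_def by auto
    have x: "x = sqrt (ip y y) *\<^sub>R e + (\<Sum>c\<in>C. ip x c *\<^sub>R c)"
      using pos[OF False] by (simp add: e_def y_def)
    have mem': "(\<Sum>c\<in>C. ip x c *\<^sub>R c) \<in> span (insert z C)" for z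
      using mem span_mono[OF subset_insertI] by blast
    have "x \<in> span (insert e C)"
      by (subst x, intro span_add span_mul mem') (simp add: span_base)
    moreover have "e \<in> span (insert x C)"
      unfolding e_def y_def by (intro span_mul span_diff mem') (simp add: span_base)
    ultimately have "span (insert e C) = span (insert x C)"
      by (intro span_eq[THEN iffD2]) (auto intro: span_base)
    then show ?thesis
      using 1 assms(2) by blast
  qed
qed

lemma orthonormal_basis_exists:
  assumes "fin_subspace S"
  obtains C where "orthonormal C" "finite C" "S = span C"
proof -
  obtain B where "finite B" "S = span B"
    using assms unfolding fin_subspace_def by blast
  have "\<exists>C. orthonormal C \<and> finite C \<and> span C = span B"
    using \<open>finite B\<close>
  proof (induction B)
    case empty
    show ?case
      by (intro exI[of _ "{}"]) (simp add: orthonormal_def)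
  next
    case (insert x B)
    then obtain C where C: "orthonormal C" "finite C" "span C = span B"
      by blast
    have "span (insert x C) = span (insert x B)"
      unfolding span_insert C(3) ..
    then show ?case
      using orthonormal_extend[OF C(1,2), of x] by auto
  qed
  then show ?thesis
    using that \<open>S = span B\<close> by blast
qed

text \<open>The values of \<phi> on an orthonormal basis of \<open>W\<close> are the coordinates of
  the representing vector. Projections and adjoints are both obtained from this.\<close>

lemma riesz:
  assumes "fin_subspace W" "linear \<phi>"
  obtains x where "x \<in> W" "\<And>u. u \<in> W \<Longrightarrow> \<phi> u = ip u x"
proof -
  obtain C where C: "orthonormal C" "finite C" "W = span C"
    using orthonormal_basis_exists[OF assms(1)] .
  define x where "x = (\<Sum>c\<in>C. \<phi> c *\<^sub>R c)"
  have "\<phi> u = ip u x" if "u \<in> W" for u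
  proof -
    have "\<phi> u = \<phi> (\<Sum>c\<in>C. ip u c *\<^sub>R c)"
      using orthonormal_expand[OF C(1,2)] that C(3) by simp
    also have "\<dots> = ip u x"
      by (simp add: x_def linear_sum[OF assms(2)] linear_cmul[OF assms(2)] sum_right scale_right mult.commute)
    finally show ?thesis .
  qed
  moreover have "x \<in> W"
    unfolding x_def C(3) by (intro span_sum span_mul span_base)
  ultimately show ?thesis
    using that by blast
qed

text \<open>The projection of \<open>x\<close> is the vector of \<open>W\<close> that represents the
  functional \<open>ip u x\<close> of \<open>u\<close>.\<close>

lemma projection_exists:
  assumes "fin_subspace W"
  obtains y where "y \<in> W" "\<And>u. u \<in> W \<Longrightarrow> ip u (x - y) = 0"
proof -
  obtain y where "y \<in> W" "\<And>u. u \<in> W \<Longrightarrow> ip u x = ip u y"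
    by (rule riesz[OF assms linear_left[of x]]) blast
  then show ?thesis
    using that[of y] by (simp add: diff_right)
qed

text \<open>Orthonormal bases of the summands together form an orthonormal basis of the span. They
  are disjoint, since a common vector would have length 1 and be orthogonal to itself, so
  cardinalities add.\<close>

lemma dim_orthogonal_sum:
  assumes "finite I" "\<And>i. i \<in> I \<Longrightarrow> fin_subspace (E i)"
    and orth: "\<And>i j x y. i \<in> I \<Longrightarrow> j \<in> I \<Longrightarrow> i \<noteq> j \<Longrightarrow> x \<in> E i \<Longrightarrow> y \<in> E j \<Longrightarrow> ip x y = 0"
  shows "dim (span (\<Union>i\<in>I. E i)) = (\<Sum>i\<in>I. dim (E i))"
proof -
  have "\<exists>C. orthonormal C \<and> finite C \<and> E i = span C" if "i \<in> I" for i
    by (rule orthonormal_basis_exists[OF assms(2)[OF that]]) blast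
  then obtain C where C: "\<And>i. i \<in> I \<Longrightarrow> orthonormal (C i) \<and> finite (C i) \<and> E i = span (C i)"
    by metis
  have CE: "c \<in> E i" if "i \<in> I" "c \<in> C i" for i c
    using C that by (simp add: span_base)
  have disj: "C i \<inter> C j = {}" if "i \<in> I" "j \<in> I" "i \<noteq> j" for i j
  proof (rule ccontr)
    assume "C i \<inter> C j \<noteq> {}"
    then obtain c where "c \<in> C i" "c \<in> C j" by blast
    then show False
      using orth[OF that CE CE, of c c] C that unfolding orthonormal_def by force
  qed
  have "orthonormal (\<Union>i\<in>I. C i)"
    unfolding orthonormal_def
  proof (intro ballI)
    fix b b' assume "b \<in> (\<Union>i\<in>I. C i)" "b' \<in> (\<Union>i\<in>I. C i)"
    then obtain i j where ij: "i \<in> I" "b \<in> C i" "j \<in> I" "b' \<in> C j"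
      by blast
    show "ip b b' = of_bool (b = b')"
    proof (cases "i = j")
      case True
      then show ?thesis
        using ij C[of i] unfolding orthonormal_def by blast
    next
      case False
      then have "b \<noteq> b'"
        using disj ij by blast
      then show ?thesis
        using orth[OF ij(1,3) False CE[OF ij(1,2)] CE[OF ij(3,4)]] by simp
    qed
  qed
  then have "dim (span (\<Union>i\<in>I. C i)) = card (\<Union>i\<in>I. C i)"
    using orthonormal_independent dim_span_eq_card_independent by blast
  also have "\<dots> = (\<Sum>i\<in>I. card (C i))"
    using C disj assms(1) by (intro card_UN_disjoint) auto
  also have "\<dots> = (\<Sum>i\<in>I. dim (E i))"
    using C by (intro sum.cong) (auto simp: dim_span_eq_card_independent orthonormal_independent simp del: dim_span)
  also have "span (\<Union>i\<in>I. C i) = span (\<Union>i\<in>I. E i)"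
  proof (rule span_eq[THEN iffD2], intro conjI UN_least)
    fix i assume i: "i \<in> I"
    show "C i \<subseteq> span (\<Union>i\<in>I. E i)"
      using CE i by (auto intro!: span_base)
    have "span (C i) \<subseteq> span (\<Union>i\<in>I. C i)"
      using i by (intro span_mono) auto
    then show "E i \<subseteq> span (\<Union>i\<in>I. C i)"
      using C i by simp
  qed
  finally show ?thesis .
qed

section \<open>Self-adjoint operators and the spectral theorem\<close>

definition self_adjoint_on :: "'v set \<Rightarrow> ('v \<Rightarrow> 'v) \<Rightarrow> bool" where
  "self_adjoint_on W T \<longleftrightarrow> T ` W \<subseteq> W \<and> (\<forall>x\<in>W. \<forall>y\<in>W. ip (T x) y = ip x (T y))"

lemma self_adjointD: "self_adjoint_on W T \<Longrightarrow> x \<in> W \<Longrightarrow> y \<in> W \<Longrightarrow> ip (T x) y = ip x (T y)"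
  by (simp add: self_adjoint_on_def)

lemma self_adjoint_closed: "self_adjoint_on W T \<Longrightarrow> x \<in> W \<Longrightarrow> T x \<in> W"
  by (auto simp: self_adjoint_on_def)

text \<open>Symmetry alone yields linearity on \<open>W\<close>: moving \<open>T\<close> to the test
  vector \<open>u\<close> leaves an expression additive in the other argument. Thus the Laplacian,
  built from adjoints given by descriptions, gets its linearity for free.\<close>

lemma self_adjoint_add:
  assumes "self_adjoint_on W T" "subspace W" "x \<in> W" "y \<in> W"
  shows "T (x + y) = T x + T y"
proof (rule eqI[OF assms(2)])
  fix u assume "u \<in> W"
  note [simp] = self_adjointD[OF assms(1) \<open>u \<in> W\<close>, symmetric]
  show "ip u (T (x + y)) = ip u (T x + T y)"
    using assms(2-4) by (simp add: subspace_add add_right)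
qed (simp_all add: assms subspace_add self_adjoint_closed[OF assms(1)])

lemma self_adjoint_scale:
  assumes "self_adjoint_on W T" "subspace W" "x \<in> W"
  shows "T (r *\<^sub>R x) = r *\<^sub>R T x"
proof (rule eqI[OF assms(2)])
  fix u assume "u \<in> W"
  note [simp] = self_adjointD[OF assms(1) \<open>u \<in> W\<close>, symmetric]
  show "ip u (T (r *\<^sub>R x)) = ip u (r *\<^sub>R T x)"
    using assms(2,3) by (simp add: subspace_scale scale_right)
qed (simp_all add: assms subspace_scale self_adjoint_closed[OF assms(1)])

text \<open>A maximum point of the Rayleigh quotient is an eigenvector. Compactness is used for the
  coordinates with respect to an orthonormal basis, as the form carries no topology.\<close>

lemma eigenvector_exists:
  assumes "fin_subspace W" "W \<noteq> {0}" and T: "self_adjoint_on W T"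
  obtains x \<mu> where "x \<in> W" "x \<noteq> 0" "T x = \<mu> *\<^sub>R x"
proof -
  have W: "subspace W"
    by (simp add: assms(1) fin_subspace_subspace)
  obtain C where C: "orthonormal C" "finite C" "W = span C"
    using orthonormal_basis_exists[OF assms(1)] .
  \<comment> \<open>Coordinate vectors are functions on the whole type. Pinning the coordinates
    outside \<open>C\<close> to 0 makes \<open>K\<close> a product of compact sets; \<open>S\<close>
    is then the unit sphere inside this cube.\<close>
  define K where "K = {t. \<forall>b. t b \<in> (if b \<in> C then {-1..1} else {0::real})}"
  have "K = Pi\<^sub>E UNIV (\<lambda>b. if b \<in> C then {-1..1} else {0})"
    by (auto simp: K_def PiE_def Pi_def)
  moreover have "compactin (product_topology (\<lambda>_. euclidean) UNIV)
      (Pi\<^sub>E UNIV (\<lambda>b. if b \<in> C then {-1..1} else {0::real}))"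
    unfolding compactin_PiE by auto
  ultimately have K: "compact K"
    by (simp add: euclidean_product_topology)
  define S where "S = K \<inter> {t. (\<Sum>b\<in>C. (t b)\<^sup>2) = 1}"
  define vec where "vec t = (\<Sum>b\<in>C. t b *\<^sub>R b)" for t :: "'v \<Rightarrow> real"
  \<comment> \<open>The quadratic form of \<open>T\<close> in coordinates, a polynomial in finitely
    many of them and hence continuous.\<close>
  define q where "q t = (\<Sum>b\<in>C. \<Sum>b'\<in>C. t b * t b' * ip (T b) b')" for t :: "'v \<Rightarrow> real"
  have vecW: "vec t \<in> W" for t
    unfolding vec_def C(3) by (intro span_sum span_mul span_base)
  have CW: "b \<in> W" if "b \<in> C" for b
    using C(3) that by (simp add: span_base)
  have TW: "T x \<in> W" if "x \<in> W" for x
    using self_adjoint_closed[OF T that] .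
  have sym: "ip (T x) y = ip x (T y)" if "x \<in> W" "y \<in> W" for x y
    using self_adjointD[OF T that] .
  have ip_vec: "ip (vec t) (vec t) = (\<Sum>b\<in>C. (t b)\<^sup>2)" for t
  proof -
    have "ip (vec t) (vec t) = (\<Sum>b\<in>C. t b * ip (vec t) b)"
      by (subst (2) vec_def) (simp add: sum_right scale_right)
    then show ?thesis
      using orthonormal_sum[OF C(1,2)] by (simp add: vec_def power2_eq_square)
  qed
  have q: "ip (T (vec t)) (vec t) = q t" for t
  proof -
    have "ip (T (vec t)) (vec t) = (\<Sum>b'\<in>C. t b' * ip (vec t) (T b'))"
      using sym[OF vecW CW] by (subst (2) vec_def) (simp add: sum_right scale_right)
    also have "\<dots> = (\<Sum>b'\<in>C. t b' * (\<Sum>b\<in>C. t b * ip b (T b')))"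
      by (simp add: vec_def sum_left scale_left)
    also have "\<dots> = q t"
      unfolding q_def by (subst sum.swap) (simp add: sum_distrib_left sym[OF CW CW] ac_simps)
    finally show ?thesis .
  qed
  have "closed {t :: 'v \<Rightarrow> real. (\<Sum>b\<in>C. (t b)\<^sup>2) = 1}"
    by (intro closed_Collect_eq continuous_intros continuous_on_product_coordinates)
  then have "compact S"
    unfolding S_def using K by (rule compact_Int_closed[rotated])
  moreover have "continuous_on S q"
    unfolding q_def
    by (intro continuous_intros continuous_on_subset[OF continuous_on_product_coordinates]) auto
  moreover
  \<comment> \<open>Each coordinate of a unit vector is at most 1 in absolute value, because the
    squares sum to 1; so the cube contains the whole sphere.\<close>
  have unit: "\<exists>t\<in>S. vec t = x" if x: "x \<in> W" "ip x x = 1" for x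
  proof -
    define t where "t b = (if b \<in> C then ip x b else 0)" for b
    have vt: "vec t = x"
      using orthonormal_expand[OF C(1,2)] x(1) C(3) by (simp add: vec_def t_def)
    then have t1: "(\<Sum>b\<in>C. (t b)\<^sup>2) = 1"
      using ip_vec x(2) by metis
    have "(t b)\<^sup>2 \<le> 1" if "b \<in> C" for b
      unfolding t1[symmetric] using that C(2) by (intro member_le_sum) auto
    then have "t b \<in> {-1..1}" if "b \<in> C" for b
      using that by (auto simp: abs_square_le_1 abs_le_iff)
    then have "t \<in> K"
      by (auto simp: K_def t_def)
    then show ?thesis
      using t1 vt by (auto simp: S_def)
  qed
  have normalize: "(1 / sqrt (ip x x)) *\<^sub>R x \<in> W \<and>
      ip ((1 / sqrt (ip x x)) *\<^sub>R x) ((1 / sqrt (ip x x)) *\<^sub>R x) = 1" if "x \<in> W" "x \<noteq> 0" for x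
    using pos[OF that(2)] W that(1)
    by (simp add: scale_left scale_right subspace_scale field_simps flip: power2_eq_square)
  obtain w where w: "w \<in> W" "w \<noteq> 0"
    using assms(2) subspace_0[OF W] by blast
  have "S \<noteq> {}"
    using unit normalize[OF w] by blast
  ultimately obtain t0 where t0: "t0 \<in> S" "\<And>t. t \<in> S \<Longrightarrow> q t \<le> q t0"
    using continuous_attains_sup by metis
  define x0 where "x0 = vec t0"
  define \<mu> where "\<mu> = q t0"
  have x0: "x0 \<in> W" "ip x0 x0 = 1" "ip (T x0) x0 = \<mu>"
    using t0(1) by (auto simp: x0_def vecW ip_vec q \<mu>_def S_def)
  \<comment> \<open>Both sides are homogeneous of degree two, so the bound extends from the unit
    sphere to all of \<open>W\<close>.\<close>
  have max: "ip (T x) x \<le> \<mu> * ip x x" if x: "x \<in> W" for x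
  proof (cases "x = 0")
    case False
    define r where "r = 1 / sqrt (ip x x)"
    obtain t where t: "t \<in> S" "vec t = r *\<^sub>R x"
      using unit normalize[OF x False] by (auto simp: r_def)
    have "ip (T (r *\<^sub>R x)) (r *\<^sub>R x) \<le> \<mu>"
      using t0(2)[OF t(1)] q[of t] t(2) by (simp add: \<mu>_def)
    moreover have "ip (T (r *\<^sub>R x)) (r *\<^sub>R x) = ip (T x) x / ip x x"
      using self_adjoint_scale[OF T W x, of r] pos[OF False]
      by (simp add: r_def scale_left scale_right field_simps flip: power2_eq_square)
    ultimately show ?thesis
      using pos[OF False] by (simp add: field_simps)
  qed simp
  have "T x0 = \<mu> *\<^sub>R x0"
  proof (rule eqI[OF W])
    fix w assume w: "w \<in> W"
    \<comment> \<open>This is \<open>max\<close> at \<open>x0 + s *\<^sub>R w\<close>; the constant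
      terms cancel because \<open>x0\<close> attains \<mu>. The linear coefficient must vanish,
      which is the eigenvector equation tested against \<open>w\<close>.\<close>
    have "s * (2 * (ip (T x0) w - \<mu> * ip x0 w)) + s\<^sup>2 * (ip (T w) w - \<mu> * ip w w) \<le> 0" for s
    proof -
      have sw: "s *\<^sub>R w \<in> W"
        using W w by (rule subspace_scale)
      have "ip (T w) x0 = ip (T x0) w"
        using sym[OF w x0(1)] by (simp add: commute)
      then show ?thesis
        using max[OF subspace_add[OF W x0(1) sw]] x0 w
        by (simp add: self_adjoint_add[OF T W x0(1) sw] self_adjoint_scale[OF T W w] add_left add_right
            scale_left scale_right commute[of w x0] algebra_simps power2_eq_square)
    qed
    then have "ip (T x0) w - \<mu> * ip x0 w = 0"
      by (rule quadratic_nonpos_imp)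
    then show "ip w (T x0) = ip w (\<mu> *\<^sub>R x0)"
      by (simp add: commute[of w] scale_left)
  qed (use x0(1) TW W in \<open>auto simp: subspace_scale\<close>)
  moreover have "x0 \<noteq> 0"
    using x0(2) by auto
  ultimately show ?thesis
    using that x0(1) by blast
qed

definition eigenspace :: "'v set \<Rightarrow> ('v \<Rightarrow> 'v) \<Rightarrow> real \<Rightarrow> 'v set" where
  "eigenspace W T \<mu> = {x \<in> W. T x = \<mu> *\<^sub>R x}"

lemma fin_subspace_eigenspace:
  assumes "fin_subspace W" "self_adjoint_on W T"
  shows "fin_subspace (eigenspace W T \<mu>)"
proof (rule fin_subspace_subset[OF _ _ assms(1)])
  have W: "subspace W"
    by (simp add: assms(1) fin_subspace_subspace)
  have "T 0 = 0"
    using self_adjoint_scale[OF assms(2) W subspace_0[OF W], of 0] by simp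
  then show "subspace (eigenspace W T \<mu>)"
    using W by (auto simp: subspace_def eigenspace_def self_adjoint_add[OF assms(2) W]
        self_adjoint_scale[OF assms(2) W] scaleR_add_right)
qed (auto simp: eigenspace_def)

lemma eigenspace_orthogonal:
  assumes "self_adjoint_on W T" "\<mu> \<noteq> \<nu>" "x \<in> eigenspace W T \<mu>" "y \<in> eigenspace W T \<nu>"
  shows "ip x y = 0"
proof -
  have "ip (T x) y = ip x (T y)"
    using assms by (auto simp: self_adjoint_on_def eigenspace_def)
  then show ?thesis
    using assms by (auto simp: eigenspace_def scale_left scale_right)
qed

text \<open>A choice of one unit eigenvector per eigenvalue is an orthonormal, hence independent,
  family in \<open>W\<close>, so it is finite; the choice is injective because eigenspaces are
  orthogonal.\<close>

lemma finite_eigenvalues: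
  assumes "fin_subspace W" "self_adjoint_on W T"
  shows "finite {\<mu>. eigenspace W T \<mu> \<noteq> {0}}"
proof -
  let ?M = "{\<mu>. eigenspace W T \<mu> \<noteq> {0}}"
  have "\<exists>x. x \<in> eigenspace W T \<mu> \<and> ip x x = 1" if "\<mu> \<in> ?M" for \<mu>
  proof -
    have S: "subspace (eigenspace W T \<mu>)"
      by (rule fin_subspace_subspace[OF fin_subspace_eigenspace[OF assms]])
    have "eigenspace W T \<mu> \<noteq> {0}"
      using that by simp
    then obtain x where x: "x \<in> eigenspace W T \<mu>" "x \<noteq> 0"
      using subspace_0[OF S] by blast
    then show ?thesis
      using pos[OF x(2)] subspace_scale[OF S x(1), of "1 / sqrt (ip x x)"]
      by (intro exI[of _ "(1 / sqrt (ip x x)) *\<^sub>R x"])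
        (simp add: scale_left scale_right flip: power2_eq_square)
  qed
  then obtain e where e: "\<And>\<mu>. \<mu> \<in> ?M \<Longrightarrow> e \<mu> \<in> eigenspace W T \<mu> \<and> ip (e \<mu>) (e \<mu>) = 1"
    by metis
  have inj: "inj_on e ?M"
  proof (rule inj_onI, rule ccontr)
    fix \<mu> \<nu> assume "\<mu> \<in> ?M" "\<nu> \<in> ?M" "e \<mu> = e \<nu>" "\<mu> \<noteq> \<nu>"
    then show False
      using eigenspace_orthogonal[OF assms(2) \<open>\<mu> \<noteq> \<nu>\<close>, of "e \<mu>" "e \<nu>"] e[of \<mu>] e[of \<nu>] by simp
  qed
  have "orthonormal (e ` ?M)"
    unfolding orthonormal_def
  proof (intro ballI, elim imageE)
    fix b b' \<mu> \<nu> assume *: "b = e \<mu>" "b' = e \<nu>" "\<mu> \<in> ?M" "\<nu> \<in> ?M"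
    show "ip b b' = of_bool (b = b')"
      using eigenspace_orthogonal[OF assms(2), of \<mu> \<nu> b b'] e[of \<mu>] e[of \<nu>] * by (cases "\<mu> = \<nu>") force+
  qed
  then have "independent (e ` ?M)"
    by (rule orthonormal_independent)
  moreover obtain B where "finite B" "W = span B"
    using assms(1) unfolding fin_subspace_def by blast
  moreover have "e ` ?M \<subseteq> W"
    using e by (auto simp: eigenspace_def)
  ultimately have "finite (e ` ?M)"
    using independent_span_bound by blast
  then show ?thesis
    using inj finite_imageD by blast
qed

text \<open>The orthogonal complement \<open>U\<close> of the span of all eigenspaces is invariant
  under \<open>T\<close>. A nonzero \<open>U\<close> would contain an eigenvector, which would also
  lie in the span and be orthogonal to itself. So the eigenspaces span \<open>W\<close>, and being
  orthogonal they have additive dimensions.\<close>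

theorem dim_eq_sum_eigenspaces:
  assumes "fin_subspace W" "self_adjoint_on W T"
  shows "dim W = (\<Sum>\<mu>\<in>{\<mu>. eigenspace W T \<mu> \<noteq> {0}}. dim (eigenspace W T \<mu>))"
proof -
  let ?M = "{\<mu>. eigenspace W T \<mu> \<noteq> {0}}"
  let ?P = "span (\<Union>\<mu>\<in>?M. eigenspace W T \<mu>)"
  have W: "subspace W"
    by (simp add: assms(1) fin_subspace_subspace)
  have PW: "?P \<subseteq> W"
    using W by (intro span_minimal) (auto simp: eigenspace_def)
  have finP: "fin_subspace ?P"
    using fin_subspace_subset[OF _ PW assms(1)] by simp
  define U where "U = {x \<in> W. \<forall>y\<in>?P. ip x y = 0}"
  have U: "subspace U"
    using W by (auto simp: U_def subspace_def add_left scale_left)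
  have TU: "T x \<in> U" if "x \<in> U" for x
  proof -
    have x: "x \<in> W"
      using that by (simp add: U_def)
    \<comment> \<open>By linearity in \<open>y\<close> it suffices to test eigenvectors, on which
      \<open>T\<close> can be moved over and acts as a scalar.\<close>
    have "ip (T x) y = 0" if "y \<in> ?P" for y
      using that
    proof (rule linear_eq_0_on_span[OF linear_right, rotated])
      fix y assume "y \<in> (\<Union>\<mu>\<in>?M. eigenspace W T \<mu>)"
      then obtain \<mu> where y: "y \<in> W" "T y = \<mu> *\<^sub>R y" "y \<in> ?P"
        by (auto simp: eigenspace_def intro: span_base)
      then show "ip (T x) y = 0"
        using assms(2) x \<open>x \<in> U\<close> by (auto simp: self_adjoint_on_def U_def scale_right)
    qed
    then show ?thesis
      using x assms(2) by (auto simp: self_adjoint_on_def U_def)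
  qed
  have "U = {0}"
  proof (rule ccontr)
    assume ne: "U \<noteq> {0}"
    have "self_adjoint_on U T"
      using assms(2) TU by (auto simp: self_adjoint_on_def U_def)
    moreover have "fin_subspace U"
      using U by (rule fin_subspace_subset) (auto simp: U_def assms(1))
    ultimately obtain x \<mu> where x: "x \<in> U" "x \<noteq> 0" "T x = \<mu> *\<^sub>R x"
      using eigenvector_exists ne by metis
    then have "x \<in> eigenspace W T \<mu>"
      by (simp add: U_def eigenspace_def)
    then have "x \<in> ?P"
      using x(2) by (intro span_base) auto
    then have "ip x x = 0"
      using x(1) by (simp add: U_def)
    then show False
      using x(2) by (simp add: eq_0_iff)
  qed
  have "W \<subseteq> ?P"
  proof
    fix x assume x: "x \<in> W"
    obtain y where y: "y \<in> ?P" "\<And>u. u \<in> ?P \<Longrightarrow> ip u (x - y) = 0"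
      by (rule projection_exists[OF finP, of x]) blast
    then have "x - y \<in> U"
      using x PW W by (auto simp: U_def subspace_diff commute)
    then show "x \<in> ?P"
      using y(1) \<open>U = {0}\<close> by simp
  qed
  then have "dim W = dim ?P"
    using PW subset_antisym by metis
  also have "\<dots> = (\<Sum>\<mu>\<in>?M. dim (eigenspace W T \<mu>))"
    by (rule dim_orthogonal_sum[OF finite_eigenvalues[OF assms] fin_subspace_eigenspace[OF assms]
          eigenspace_orthogonal[OF assms(2)]])
  finally show ?thesis .
qed

section \<open>Dimension counts, adjoints and the Hodge decomposition\<close>

lemma dim_orthogonal_complement:
  assumes "fin_subspace K" "subspace A" "A \<subseteq> K"
  shows "dim K = dim A + dim {x \<in> K. \<forall>y\<in>A. ip x y = 0}"
proof -
  let ?A' = "{x \<in> K. \<forall>y\<in>A. ip x y = 0}"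
  have K: "subspace K"
    by (rule fin_subspace_subspace[OF assms(1)])
  have A: "fin_subspace A"
    using assms by (rule fin_subspace_subset[rotated 2])
  have "subspace ?A'"
    using K by (auto simp: subspace_def add_left scale_left)
  then have A': "fin_subspace ?A'"
    by (rule fin_subspace_subset[OF _ _ assms(1)]) auto
  \<comment> \<open>The two summands are indexed by the Booleans so that
    \<open>dim_orthogonal_sum\<close> applies.\<close>
  define E where "E b = (if b then A else ?A')" for b
  have "dim (span (\<Union>b\<in>UNIV. E b)) = (\<Sum>b\<in>UNIV. dim (E b))"
    by (rule dim_orthogonal_sum) (auto simp: E_def A A' commute split: if_splits)
  moreover have "span (\<Union>b\<in>UNIV. E b) = K"
  proof (rule subset_antisym)
    show "span (\<Union>b\<in>UNIV. E b) \<subseteq> K"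
      using K assms(3) by (intro span_minimal) (auto simp: E_def)
    show "K \<subseteq> span (\<Union>b\<in>UNIV. E b)"
    proof
      fix x assume x: "x \<in> K"
      obtain y where y: "y \<in> A" "\<And>u. u \<in> A \<Longrightarrow> ip u (x - y) = 0"
        by (rule projection_exists[OF A, of x]) blast
      have "x - y \<in> ?A'"
        using y x K assms(3) by (auto simp: subspace_diff commute[of "x - y"])
      then have "y + (x - y) \<in> span (\<Union>b\<in>UNIV. E b)"
        using y(1) by (intro span_add span_base) (auto simp: E_def intro: exI[of _ True] exI[of _ False])
      then show "x \<in> span (\<Union>b\<in>UNIV. E b)"
        by simp
    qed
  qed
  ultimately show ?thesis
    by (simp add: UNIV_bool E_def del: dim_span)
qed

text \<open>On the orthogonal complement of its kernel \<open>d\<close> is injective, and it has the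
  same image there as on \<open>W\<close>, since removing the kernel component of a vector does not
  change its value.\<close>

lemma rank_nullity:
  fixes d :: "'v \<Rightarrow> 'w::real_vector"
  assumes "fin_subspace W" "linear d"
  shows "dim W = dim {x \<in> W. d x = 0} + dim (d ` W)"
proof -
  let ?K = "{x \<in> W. d x = 0}"
  let ?L = "{x \<in> W. \<forall>y\<in>?K. ip x y = 0}"
  have W: "subspace W"
    by (rule fin_subspace_subspace[OF assms(1)])
  have K: "subspace ?K"
    using W by (auto simp: subspace_def linear_add[OF assms(2)] linear_cmul[OF assms(2)] linear_0[OF assms(2)])
  have L: "subspace ?L"
    using W by (auto simp: subspace_def add_left scale_left)
  have "inj_on d ?L"
    unfolding linear_inj_on_iff_eq_0[OF assms(2) L]
  proof (intro ballI impI)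
    fix x assume "x \<in> ?L" "d x = 0"
    then have "ip x x = 0"
      by blast
    then show "x = 0"
      by (simp add: eq_0_iff)
  qed
  then have "dim (d ` ?L) = dim ?L"
    using L by (intro dim_image_inj_on[OF assms(2)]) (simp add: span_eq_iff[THEN iffD2])
  moreover have "d ` ?L = d ` W"
  proof (rule subset_antisym)
    show "d ` ?L \<subseteq> d ` W"
      by auto
    show "d ` W \<subseteq> d ` ?L"
    proof
      fix z assume "z \<in> d ` W"
      then obtain x where x: "x \<in> W" "z = d x"
        by blast
      have "fin_subspace ?K"
        using K by (rule fin_subspace_subset[OF _ _ assms(1)]) auto
      then obtain y where y: "y \<in> ?K" "\<And>u. u \<in> ?K \<Longrightarrow> ip u (x - y) = 0"
        by (rule projection_exists[of _ x]) blast
      have "x - y \<in> ?L"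
        using x y W by (auto simp: subspace_diff commute[of "x - y"])
      moreover have "z = d (x - y)"
        using x y(1) by (simp add: linear_diff[OF assms(2)])
      ultimately show "z \<in> d ` ?L"
        by blast
    qed
  qed
  ultimately show ?thesis
    using dim_orthogonal_complement[OF assms(1) K] by simp
qed

text \<open>Same form as \<open>boundary_adjoint\<close>: the defining equation mentions only the
  source space \<open>W\<close>, so \<open>y\<close> may be any vector.\<close>

definition adjoint_on :: "'v set \<Rightarrow> ('v \<Rightarrow> 'v) \<Rightarrow> 'v \<Rightarrow> 'v" where
  "adjoint_on W d y = (THE x. x \<in> W \<and> (\<forall>u\<in>W. ip (d u) y = ip u x))"

lemma adjoint_on_unique:
  assumes "subspace W" "x \<in> W" "\<And>u. u \<in> W \<Longrightarrow> ip (d u) y = ip u x"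
  shows "adjoint_on W d y = x"
  unfolding adjoint_on_def
proof (rule the_equality)
  fix x' assume x': "x' \<in> W \<and> (\<forall>u\<in>W. ip (d u) y = ip u x')"
  show "x' = x"
    by (rule eqI[OF assms(1)]) (use x' assms in auto)
qed (use assms in auto)

lemma adjoint_on:
  assumes "fin_subspace W" "linear d"
  shows "adjoint_on W d y \<in> W" "u \<in> W \<Longrightarrow> ip (d u) y = ip u (adjoint_on W d y)"
proof -
  have "linear (\<lambda>u. ip (d u) y)"
    using linear_compose[OF assms(2) linear_left[of y]] by (simp add: o_def)
  then obtain x where "x \<in> W" "\<And>u. u \<in> W \<Longrightarrow> ip (d u) y = ip u x"
    by (rule riesz[OF assms(1)]) blast
  moreover from this have "adjoint_on W d y = x"
    by (rule adjoint_on_unique[OF fin_subspace_subspace[OF assms(1)]])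
  ultimately show "adjoint_on W d y \<in> W" "u \<in> W \<Longrightarrow> ip (d u) y = ip u (adjoint_on W d y)"
    by auto
qed

lemma adjoint_on_scale:
  assumes "fin_subspace W" "linear d"
  shows "adjoint_on W d (r *\<^sub>R y) = r *\<^sub>R adjoint_on W d y"
  using adjoint_on[OF assms] fin_subspace_subspace[OF assms(1)]
  by (intro adjoint_on_unique) (auto simp: subspace_scale scale_right)

text \<open>The kernel of the Laplacian of \<open>W\<^sub>2 \<rightarrow> W\<^sub>1 \<rightarrow> V\<close> is the orthogonal complement of the
  boundaries in the cycles, so its positive eigenspaces account for the ranks of both maps.\<close>

theorem sum_dim_positive_eigenspaces:
  fixes d1 d2 :: "'v \<Rightarrow> 'v"
  assumes fin: "fin_subspace W1" "fin_subspace W2"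
    and lin: "linear d1" "linear d2"
    and chain: "d2 ` W2 \<subseteq> W1" "\<And>x. x \<in> W2 \<Longrightarrow> d1 (d2 x) = 0"
    and T_def: "\<And>x. T x = adjoint_on W1 d1 (d1 x) + d2 (adjoint_on W2 d2 x)"
  shows "(\<Sum>\<mu>\<in>{\<mu>. \<mu> > 0 \<and> eigenspace W1 T \<mu> \<noteq> {0}}. dim (eigenspace W1 T \<mu>)) =
    dim (d1 ` W1) + dim (d2 ` W2)"
proof -
  have W1: "subspace W1"
    by (rule fin_subspace_subspace[OF fin(1)])
  note a1 = adjoint_on[OF fin(1) lin(1)] and a2 = adjoint_on[OF fin(2) lin(2)]
  have TW: "T x \<in> W1" for x
    using W1 a1(1) a2(1) chain(1) by (auto simp: T_def intro!: subspace_add)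
  \<comment> \<open>The form of the Laplacian is a sum of two inner products; symmetry, nonnegative
    eigenvalues and the description of the kernel all come from this identity.\<close>
  have form: "ip (T x) y = ip (d1 x) (d1 y) + ip (adjoint_on W2 d2 x) (adjoint_on W2 d2 y)"
    if "y \<in> W1" for x y
    using a1(2)[OF that, of "d1 x"] a2(2)[OF a2(1), of x y]
    by (simp add: T_def add_left commute[of _ y] commute[of "d1 x"] add_right)
  have sa: "self_adjoint_on W1 T"
    unfolding self_adjoint_on_def using TW
    by (auto simp: form commute[of _ "T _"]) (simp add: commute)
  let ?M = "{\<mu>. eigenspace W1 T \<mu> \<noteq> {0}}" and ?P = "{\<mu>. \<mu> > 0 \<and> eigenspace W1 T \<mu> \<noteq> {0}}"
  let ?K = "{x \<in> W1. d1 x = 0}"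
  have finM: "finite ?M"
    by (rule finite_eigenvalues[OF fin(1) sa])
  then have "finite ?P"
    by (rule rev_finite_subset) auto
  have nonneg_ev: "\<mu> \<ge> 0" if "\<mu> \<in> ?M" for \<mu>
  proof -
    have "subspace (eigenspace W1 T \<mu>)"
      by (rule fin_subspace_subspace[OF fin_subspace_eigenspace[OF fin(1) sa]])
    moreover have "eigenspace W1 T \<mu> \<noteq> {0}"
      using that by simp
    ultimately obtain x where x: "x \<in> eigenspace W1 T \<mu>" "x \<noteq> 0"
      using subspace_0 by fastforce
    then have "\<mu> * ip x x = ip (T x) x" "x \<in> W1"
      by (auto simp: eigenspace_def scale_left)
    then have "\<mu> * ip x x \<ge> 0"
      by (simp add: form nonneg)
    then show ?thesis
      using pos[OF x(2)] by (simp add: zero_le_mult_iff)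
  qed
  \<comment> \<open>For a harmonic \<open>x\<close> both squares in \<open>form\<close> vanish.
    Vanishing of the second adjoint at \<open>x\<close> means that \<open>x\<close> is orthogonal to
    the boundaries.\<close>
  have ker: "eigenspace W1 T 0 = {x \<in> ?K. \<forall>y\<in>d2 ` W2. ip x y = 0}"
  proof (intro subset_antisym subsetI)
    fix x assume x: "x \<in> eigenspace W1 T 0"
    then have "x \<in> W1" "ip (T x) x = 0"
      by (auto simp: eigenspace_def)
    then have "ip (d1 x) (d1 x) = 0" "ip (adjoint_on W2 d2 x) (adjoint_on W2 d2 x) = 0"
      using form[of x x] nonneg[of "d1 x"] nonneg[of "adjoint_on W2 d2 x"] by auto
    then have "d1 x = 0" "adjoint_on W2 d2 x = 0"
      by (auto simp: eq_0_iff)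
    then show "x \<in> {x \<in> ?K. \<forall>y\<in>d2 ` W2. ip x y = 0}"
      using a2(2)[of _ x] \<open>x \<in> W1\<close> by (auto simp: commute[of x])
  next
    fix x assume x: "x \<in> {x \<in> ?K. \<forall>y\<in>d2 ` W2. ip x y = 0}"
    then have "ip (adjoint_on W2 d2 x) (adjoint_on W2 d2 x) = 0"
      using a2(1)[of x] a2(2)[OF a2(1), of x x] by (simp add: commute[of _ x])
    then have "adjoint_on W2 d2 x = 0" "d1 x = 0" "x \<in> W1"
      using x by (auto simp: eq_0_iff)
    moreover have "adjoint_on W1 d1 0 = 0"
      using subspace_0[OF W1] by (intro adjoint_on_unique[OF W1]) auto
    ultimately show "x \<in> eigenspace W1 T 0"
      by (simp add: eigenspace_def T_def linear_0[OF lin(2)])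
  qed
  have K: "subspace ?K"
    using W1 by (auto simp: subspace_def linear_add[OF lin(1)] linear_cmul[OF lin(1)] linear_0[OF lin(1)])
  have "fin_subspace ?K"
    using K by (rule fin_subspace_subset[OF _ _ fin(1)]) auto
  moreover have "subspace (d2 ` W2)"
    by (rule fin_subspace_subspace[OF fin_subspace_image[OF lin(2) fin(2)]])
  ultimately have dimK: "dim ?K = dim (d2 ` W2) + dim (eigenspace W1 T 0)"
    unfolding ker using chain by (intro dim_orthogonal_complement) auto
  \<comment> \<open>Inserting 0 is harmless when it is not an eigenvalue: its eigenspace is then
    \<open>{0}\<close>, of dimension 0.\<close>
  have "(\<Sum>\<mu>\<in>?M. dim (eigenspace W1 T \<mu>)) = (\<Sum>\<mu>\<in>insert 0 ?P. dim (eigenspace W1 T \<mu>))"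
    using finM nonneg_ev by (intro sum.mono_neutral_cong) (auto simp: order_le_less dim_zero)
  also have "\<dots> = dim (eigenspace W1 T 0) + (\<Sum>\<mu>\<in>?P. dim (eigenspace W1 T \<mu>))"
    using \<open>finite ?P\<close> by simp
  finally show "(\<Sum>\<mu>\<in>?P. dim (eigenspace W1 T \<mu>)) = dim (d1 ` W1) + dim (d2 ` W2)"
    using dimK rank_nullity[OF fin(1) lin(1)] dim_eq_sum_eigenspaces[OF fin(1) sa] by simp
qed

end

section \<open>Chains of paths\<close>

text \<open>The product for which elementary paths are orthonormal. It is an inner product on all
  chains at once, whereas \<open>weighted_inner\<close> is meaningful only within one
  degree.\<close>

definition chain_inner :: "('b \<Rightarrow>\<^sub>0 real) \<Rightarrow> ('b \<Rightarrow>\<^sub>0 real) \<Rightarrow> real" where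
  "chain_inner x y = (\<Sum>p\<in>Poly_Mapping.keys x. Poly_Mapping.lookup x p * Poly_Mapping.lookup y p)"

lemma chain_inner_superset:
  "finite P \<Longrightarrow> Poly_Mapping.keys x \<subseteq> P \<Longrightarrow>
    chain_inner x y = (\<Sum>p\<in>P. Poly_Mapping.lookup x p * Poly_Mapping.lookup y p)"
  unfolding chain_inner_def by (rule sum.mono_neutral_left) (auto simp: in_keys_iff)

interpretation chain: inner_form "chain_inner :: ('b \<Rightarrow>\<^sub>0 real) \<Rightarrow> _"
proof
  fix x y z :: "'b \<Rightarrow>\<^sub>0 real" and r :: real
  let ?P = "Poly_Mapping.keys x \<union> Poly_Mapping.keys y"
  have P: "finite ?P" "Poly_Mapping.keys x \<subseteq> ?P" "Poly_Mapping.keys y \<subseteq> ?P"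
    by auto
  have "chain_inner u v = (\<Sum>p\<in>?P. Poly_Mapping.lookup u p * Poly_Mapping.lookup v p)"
    if "Poly_Mapping.keys u \<subseteq> ?P" for u v
    by (rule chain_inner_superset[OF P(1) that])
  note * = this
  show "chain_inner (x + y) z = chain_inner x z + chain_inner y z"
    using *[OF keys_add, of z] *[OF P(2), of z] *[OF P(3), of z]
    by (simp add: lookup_add distrib_right sum.distrib)
  have "Poly_Mapping.keys (r *\<^sub>R x) \<subseteq> Poly_Mapping.keys x"
    by (auto simp: in_keys_iff lookup_scaleR)
  then show "chain_inner (r *\<^sub>R x) z = r * chain_inner x z"
    by (simp add: chain_inner_superset[of "Poly_Mapping.keys x"] lookup_scaleR sum_distrib_left mult.assoc)
  show "chain_inner x y = chain_inner y x"
    using *[OF P(2), of y] *[OF P(3), of x] by (simp add: mult.commute)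
  assume "x \<noteq> 0"
  then have "Poly_Mapping.keys x \<noteq> {}"
    by simp
  then show "chain_inner x x > 0"
    unfolding chain_inner_def by (intro sum_pos) (auto simp: in_keys_iff zero_less_mult_iff)
qed

text \<open>Turns membership in a span of paths, as in \<open>allowed_chains\<close>, into a
  condition on supports.\<close>

lemma span_singles:
  fixes P :: "'b set"
  shows "span ((\<lambda>p. Poly_Mapping.single p (1::real)) ` P) = {x. Poly_Mapping.keys x \<subseteq> P}"
proof (rule subset_antisym)
  have "subspace {x :: 'b \<Rightarrow>\<^sub>0 real. Poly_Mapping.keys x \<subseteq> P}"
    by (auto simp: subspace_def subset_iff in_keys_iff lookup_scaleR lookup_add) (metis add.left_neutral)
  then show "span ((\<lambda>p. Poly_Mapping.single p (1::real)) ` P) \<subseteq> {x. Poly_Mapping.keys x \<subseteq> P}"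
    by (intro span_minimal) auto
  show "{x. Poly_Mapping.keys x \<subseteq> P} \<subseteq> span ((\<lambda>p. Poly_Mapping.single p (1::real)) ` P)"
  proof
    fix x :: "'b \<Rightarrow>\<^sub>0 real" assume x: "x \<in> {x. Poly_Mapping.keys x \<subseteq> P}"
    have "x = (\<Sum>p\<in>Poly_Mapping.keys x. Poly_Mapping.lookup x p *\<^sub>R Poly_Mapping.single p 1)"
      by (rule poly_mapping_eqI)
        (simp add: lookup_sum lookup_scaleR lookup_single when_def in_keys_iff if_distrib sum.delta' cong: if_cong)
    moreover have "\<dots> \<in> span ((\<lambda>p. Poly_Mapping.single p (1::real)) ` P)"
      using x by (intro span_sum span_mul span_base) auto
    ultimately show "x \<in> span ((\<lambda>p. Poly_Mapping.single p (1::real)) ` P)"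
      by simp
  qed
qed

text \<open>The set \<open>P\<close> makes it possible to compare the maps on allowed paths only,
  where all vertices belong to the digraph.\<close>

lemma linear_eq_singles:
  fixes f g :: "('b \<Rightarrow>\<^sub>0 real) \<Rightarrow> 'v::real_vector"
  assumes "linear f" "linear g" "Poly_Mapping.keys x \<subseteq> P"
    and "\<And>p. p \<in> P \<Longrightarrow> f (Poly_Mapping.single p 1) = g (Poly_Mapping.single p 1)"
  shows "f x = g x"
  by (rule linear_eq_on[OF assms(1,2), of _ "(\<lambda>p. Poly_Mapping.single p 1) ` P"])
    (use assms(3,4) in \<open>auto simp: span_singles\<close>)

section \<open>Linearity of the boundary and the vanishing of its square\<close>

lemma full_boundary_superset:
  "finite P \<Longrightarrow> Poly_Mapping.keys x \<subseteq> P \<Longrightarrow>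
    full_boundary f x = (\<Sum>p\<in>P. Poly_Mapping.lookup x p *\<^sub>R elementary_boundary f p)"
  unfolding full_boundary_def by (rule sum.mono_neutral_left) (auto simp: in_keys_iff)

lemma linear_full_boundary: "linear (full_boundary f)"
proof (rule linearI)
  fix x y :: "'a list \<Rightarrow>\<^sub>0 real" and r :: real
  \<comment> \<open>Cancellation can shrink the support of \<open>x + y\<close>, so all sums are
    extended to a common index set.\<close>
  let ?P = "Poly_Mapping.keys x \<union> Poly_Mapping.keys y"
  have "full_boundary f u = (\<Sum>p\<in>?P. Poly_Mapping.lookup u p *\<^sub>R elementary_boundary f p)"
    if "Poly_Mapping.keys u \<subseteq> ?P" for u
    using that by (intro full_boundary_superset) auto
  then show "full_boundary f (x + y) = full_boundary f x + full_boundary f y"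
    using keys_add[of x y] by (simp add: lookup_add scaleR_add_left sum.distrib)
  have "Poly_Mapping.keys (r *\<^sub>R x) \<subseteq> Poly_Mapping.keys x"
    by (auto simp: in_keys_iff lookup_scaleR)
  then show "full_boundary f (r *\<^sub>R x) = r *\<^sub>R full_boundary f x"
    by (simp add: full_boundary_superset[of "Poly_Mapping.keys x"] lookup_scaleR scaleR_sum_right)
qed

lemma linear_regular_part: "linear regular_part"
  by (rule linearI; rule poly_mapping_eqI) (simp_all add: lookup_regular_part lookup_add lookup_scaleR)

lemma linear_path_boundary: "linear (path_boundary f)"
  using linear_compose[OF linear_full_boundary linear_regular_part, of f]
  by (simp add: o_def path_boundary_def[abs_def])

lemma full_boundary_single: "full_boundary f (Poly_Mapping.single p c) = c *\<^sub>R elementary_boundary f p"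
  by (cases "c = 0") (simp_all add: full_boundary_def)

lemma path_boundary_single:
  "path_boundary f (Poly_Mapping.single p 1) = regular_part (elementary_boundary f p)"
  by (simp add: path_boundary_def full_boundary_single)

lemma scaleR_single: "r *\<^sub>R Poly_Mapping.single p c = Poly_Mapping.single p (r * c :: real)"
  by (rule poly_mapping_eqI) (simp add: lookup_scaleR lookup_single when_def)

lemma delete_nth_commute:
  assumes "j < i" "i < length p"
  shows "delete_nth (i - 1) (delete_nth j p) = delete_nth j (delete_nth i p)"
  using assms by (intro nth_equalityI) (auto simp: length_delete_nth nth_delete_nth)

text \<open>Deleting \<open>p\<^sub>i\<close> and then \<open>p\<^sub>j\<close> with \<open>j < i\<close> cancels against deleting \<open>p\<^sub>j\<close> first, after which
  \<open>p\<^sub>i\<close> has index \<open>i - 1\<close>.\<close>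

lemma full_boundary_elementary_boundary: "full_boundary f (elementary_boundary f p) = 0"
proof (cases "length p \<le> 2")
  case True
  \<comment> \<open>The faces have at most one vertex, and their boundary is 0 by
    convention.\<close>
  then have "full_boundary f (Poly_Mapping.single (delete_nth i p) c) = 0" if "i < length p" for i c
    using that by (simp add: full_boundary_single elementary_boundary_def length_delete_nth)
  then show ?thesis
    by (simp add: elementary_boundary_def linear_sum[OF linear_full_boundary] linear_0[OF linear_full_boundary])
next
  case False
  define n where "n = length p"
  define F where "F = (\<lambda>(i, j). Poly_Mapping.single (delete_nth j (delete_nth i p))
    ((-1) ^ i * f (p ! i) * ((-1) ^ j * f (delete_nth i p ! j))))"
  define lo hi where "lo = {(i, j). i < n \<and> j < i}" and "hi = {(i, j). j < n - 1 \<and> i \<le> j}"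
  have fin: "finite lo" "finite hi"
    by (rule finite_subset[of _ "{..<n} \<times> {..<n}"]; auto simp: lo_def hi_def)+
  have "full_boundary f (elementary_boundary f p) =
      (\<Sum>i<n. ((-1) ^ i * f (p ! i)) *\<^sub>R elementary_boundary f (delete_nth i p))"
    using False
    by (simp add: elementary_boundary_def[of f p] linear_sum[OF linear_full_boundary] full_boundary_single n_def)
  also have "\<dots> = (\<Sum>i<n. \<Sum>j<n - 1. F (i, j))"
    using False
    by (intro sum.cong refl)
      (simp add: elementary_boundary_def length_delete_nth scaleR_sum_right scaleR_single F_def n_def)
  also have "\<dots> = sum F ({..<n} \<times> {..<n - 1})"
    by (simp add: sum.cartesian_product)
  also have "{..<n} \<times> {..<n - 1} = lo \<union> hi"
    by (auto simp: lo_def hi_def)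
  also have "sum F (lo \<union> hi) = sum F lo + sum F hi"
    using fin by (intro sum.union_disjoint) (auto simp: lo_def hi_def)
  also have "sum F hi = (\<Sum>x\<in>lo. - F x)"
  \<comment> \<open>The pair \<open>(i, j)\<close> with \<open>i \<le> j\<close> is matched with
    \<open>(Suc j, i)\<close>. Both delete the same two vertices with the same weights, but the
    exponent of the sign grows by one.\<close>
  proof (rule sum.reindex_bij_witness[of _ "\<lambda>(i, j). (j, i - 1)" "\<lambda>(i, j). (Suc j, i)"])
    fix x assume "x \<in> hi"
    then obtain i j where x: "x = (i, j)" "j < n - 1" "i \<le> j"
      by (auto simp: hi_def)
    then show "- F (case x of (i, j) \<Rightarrow> (Suc j, i)) = F x"
      using delete_nth_commute[of i "Suc j" p]
      by (simp add: F_def nth_delete_nth n_def mult_ac single_uminus[symmetric])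
  qed (auto simp: lo_def hi_def)
  finally show ?thesis
    by (simp add: sum_negf)
qed

lemma path_boundary_path_boundary: "path_boundary f (path_boundary f x) = 0"
proof -
  have "(path_boundary f \<circ> path_boundary f) x = 0"
  proof (rule linear_eq_singles[where f = "path_boundary f \<circ> path_boundary f" and g = "\<lambda>_. 0" and P = UNIV])
    show "linear (path_boundary f \<circ> path_boundary f)"
      by (rule linear_compose[OF linear_path_boundary linear_path_boundary])
    show "linear (\<lambda>_ :: 'a list \<Rightarrow>\<^sub>0 real. 0 :: 'a list \<Rightarrow>\<^sub>0 real)"
      by (rule linear_zero)
    fix p
    have "path_boundary f (path_boundary f (Poly_Mapping.single p 1)) =
        regular_part (full_boundary f (elementary_boundary f p))"
      by (simp add: path_boundary_single path_boundary_regular_part) (simp add: path_boundary_def)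
    then show "(path_boundary f \<circ> path_boundary f) (Poly_Mapping.single p 1) = 0"
      by (simp add: full_boundary_elementary_boundary linear_0[OF linear_regular_part])
  qed simp
  then show ?thesis
    by simp
qed

section \<open>The spaces of the path complex\<close>

lemma allowed_chains_iff: "x \<in> allowed_chains G n \<longleftrightarrow> Poly_Mapping.keys x \<subseteq> allowed_paths G n"
  by (simp add: allowed_chains_def span_singles)

lemma allowed_pathsD: "p \<in> allowed_paths G n \<Longrightarrow> set p \<subseteq> pverts G \<and> int (length p) = n + 1"
  by (simp add: allowed_paths_def elementary_paths_def)

lemma finite_allowed_paths:
  assumes "pair_digraph G"
  shows "finite (allowed_paths G n)"
proof (rule finite_subset)
  show "allowed_paths G n \<subseteq> {p. set p \<subseteq> pverts G \<and> length p = nat (n + 1)}"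
    using allowed_pathsD by fastforce
  have "finite (pverts G)"
    using assms by (simp add: pair_digraph_def pair_fin_digraph.pair_finite_verts)
  then show "finite {p. set p \<subseteq> pverts G \<and> length p = nat (n + 1)}"
    by (rule finite_lists_length_eq)
qed

lemma fin_subspace_Omega:
  assumes "pair_digraph G"
  shows "fin_subspace (Omega G f n)"
proof (rule fin_subspace_subset)
  show "subspace (Omega G f n)"
    unfolding Omega_def allowed_chains_def
    by (auto simp: subspace_def span_zero linear_0[OF linear_path_boundary] linear_add[OF linear_path_boundary]
        linear_cmul[OF linear_path_boundary] intro: span_add span_mul)
  show "Omega G f n \<subseteq> allowed_chains G n"
    by (auto simp: Omega_def)
  show "fin_subspace (allowed_chains G n)"
    using finite_allowed_paths[OF assms] unfolding fin_subspace_def allowed_chains_def by blast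
qed

lemma path_boundary_Omega: "x \<in> Omega G f n \<Longrightarrow> path_boundary f x \<in> Omega G f (n - 1)"
  by (simp add: Omega_def path_boundary_path_boundary allowed_chains_iff)

section \<open>Diagonal rescaling of chains and products of weights\<close>

definition rescale :: "('b \<Rightarrow> real) \<Rightarrow> ('b \<Rightarrow>\<^sub>0 real) \<Rightarrow> 'b \<Rightarrow>\<^sub>0 real" where
  "rescale w = Poly_Mapping.mapp (\<lambda>p r. w p * r)"

lemma lookup_rescale: "Poly_Mapping.lookup (rescale w x) p = w p * Poly_Mapping.lookup x p"
  by (simp add: rescale_def lookup_mapp when_def in_keys_iff)

lemma linear_rescale: "linear (rescale w)"
  by (rule linearI; rule poly_mapping_eqI) (simp_all add: lookup_rescale lookup_add lookup_scaleR algebra_simps)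

lemma keys_rescale: "(\<And>p. w p \<noteq> 0) \<Longrightarrow> Poly_Mapping.keys (rescale w x) = Poly_Mapping.keys x"
  by (auto simp: in_keys_iff lookup_rescale)

lemma rescale_single: "rescale w (Poly_Mapping.single p c) = Poly_Mapping.single p (w p * c)"
  by (rule poly_mapping_eqI) (simp add: lookup_rescale lookup_single when_def)

lemma rescale_regular_part: "rescale w (regular_part x) = regular_part (rescale w x)"
  by (rule poly_mapping_eqI) (simp add: lookup_rescale lookup_regular_part)

lemma rescale_inverse:
  assumes "\<And>p. w p \<noteq> 0"
  shows "rescale w (rescale (\<lambda>p. inverse (w p)) x) = x"
  by (rule poly_mapping_eqI) (simp add: lookup_rescale assms)

lemma inj_rescale: "(\<And>p. w p \<noteq> 0) \<Longrightarrow> inj (rescale w)"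
  using rescale_inverse[of "\<lambda>p. inverse (w p)"] by (intro inj_on_inverseI[where g = "rescale (\<lambda>p. inverse (w p))"]) simp

lemma elementary_inner_eq:
  assumes "length p = length q"
  shows "elementary_inner g p q = (if p = q then (prod_list (map g p))\<^sup>2 else 0)"
proof (cases "p = q")
  case True
  then show ?thesis
    by (simp add: elementary_inner_def prod.distrib power2_eq_square prod.list_conv_set_nth lessThan_atLeast0)
next
  case False
  then obtain i where "i < length p" "p ! i \<noteq> q ! i"
    using assms nth_equalityI by blast
  then have "elementary_inner g p q = 0"
    unfolding elementary_inner_def by (intro prod_zero) auto
  then show ?thesis
    using False by simp
qed

text \<open>Deleting a vertex removes exactly its weight from the product, which is why rescaling
  intertwines weighted and unweighted boundaries.\<close>

lemma prod_list_delete_nth: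
  fixes f :: "'a \<Rightarrow> 'b::comm_monoid_mult"
  assumes "i < length p"
  shows "prod_list (map f p) = f (p ! i) * prod_list (map f (delete_nth i p))"
proof -
  have "prod_list (map f (take i p @ p ! i # drop (Suc i) p)) = f (p ! i) * prod_list (map f (delete_nth i p))"
    by (simp add: delete_nth_def ac_simps del: append_take_drop_id)
  then show ?thesis
    using assms by (simp add: id_take_nth_drop[symmetric])
qed

section \<open>Rescaling the weights\<close>

text \<open>For \<open>1 \<le> n \<le> N\<close> the coefficient of \<open>\<beta> n\<close> is
  \<open>(-1)^n * (n - (n - 1))\<close>; only the ends \<open>0\<close> and \<open>N + 1\<close>
  behave differently.\<close>

lemma sum_alternating_telescope:
  fixes \<beta> :: "nat \<Rightarrow> real"
  shows "(\<Sum>n = 0..N. (-1) ^ n * real n * (\<beta> n + \<beta> (n + 1))) =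
    (\<Sum>n = 0..N. (-1) ^ n * \<beta> n) - \<beta> 0 + (-1) ^ N * real N * \<beta> (N + 1)"
  by (induction N) (simp_all add: algebra_simps)

text \<open>Here \<open>h\<close> weights the boundary and \<open>g\<close> the inner product. They
  are tied to \<open>f\<close> on vertices only, while \<open>f\<close> vanishes nowhere on the
  type, so that rescaling is invertible on all chains.\<close>

locale scaled_weights =
  fixes G :: "'a pair_pre_digraph" and f h g :: "'a \<Rightarrow> real" and a b :: real
  assumes digraph: "pair_digraph G"
    and f_nonzero: "f v \<noteq> 0"
    and a_nonzero: "a \<noteq> 0" and b_nonzero: "b \<noteq> 0"
    and h: "v \<in> pverts G \<Longrightarrow> h v = a * f v"
    and g: "v \<in> pverts G \<Longrightarrow> g v = b * f v"
begin

abbreviation w :: "'a list \<Rightarrow> real" where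
  "w p \<equiv> inverse (prod_list (map f p))"

abbreviation M :: "('a list \<Rightarrow>\<^sub>0 real) \<Rightarrow> 'a list \<Rightarrow>\<^sub>0 real" where
  "M \<equiv> rescale w"

abbreviation \<Omega> :: "int \<Rightarrow> ('a list \<Rightarrow>\<^sub>0 real) set" where
  "\<Omega> \<equiv> Omega G (\<lambda>_. 1)"

abbreviation d :: "('a list \<Rightarrow>\<^sub>0 real) \<Rightarrow> 'a list \<Rightarrow>\<^sub>0 real" where
  "d \<equiv> path_boundary (\<lambda>_. 1)"

abbreviation adj :: "int \<Rightarrow> ('a list \<Rightarrow>\<^sub>0 real) \<Rightarrow> 'a list \<Rightarrow>\<^sub>0 real" where
  "adj n \<equiv> chain.adjoint_on (\<Omega> n) d"

text \<open>The unweighted Laplacian. It depends on \<open>G\<close> alone, so different instances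
  of the locale share it.\<close>

definition L :: "int \<Rightarrow> ('a list \<Rightarrow>\<^sub>0 real) \<Rightarrow> 'a list \<Rightarrow>\<^sub>0 real" where
  "L n x = adj n (d x) + d (adj (n + 1) x)"

abbreviation E :: "int \<Rightarrow> real \<Rightarrow> ('a list \<Rightarrow>\<^sub>0 real) set" where
  "E n \<equiv> chain.eigenspace (\<Omega> n) (L n)"

lemma w_nonzero: "w p \<noteq> 0"
  by (auto simp: prod_list_zero_iff f_nonzero)

lemmas fin_\<Omega> = fin_subspace_Omega[OF digraph]
lemmas adj = chain.adjoint_on[OF fin_\<Omega> linear_path_boundary]

lemma M_allowed: "M x \<in> allowed_chains G n \<longleftrightarrow> x \<in> allowed_chains G n"
  by (simp add: allowed_chains_iff keys_rescale[OF w_nonzero])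

lemma M_elementary_boundary:
  assumes "set p \<subseteq> pverts G"
  shows "w p *\<^sub>R elementary_boundary h p = a *\<^sub>R M (elementary_boundary (\<lambda>_. 1) p)"
proof -
  have "w p * h (p ! i) = a * w (delete_nth i p)" if "i < length p" for i
  proof -
    have "p ! i \<in> pverts G"
      using assms that by auto
    then show ?thesis
      using f_nonzero[of "p ! i"] by (simp add: prod_list_delete_nth[OF that, of f] h)
  qed
  then show ?thesis
    by (auto simp: elementary_boundary_def scaleR_sum_right scaleR_single linear_sum[OF linear_rescale]
        rescale_single linear_0[OF linear_rescale] mult_ac intro!: sum.cong arg_cong2[of _ _ _ _ Poly_Mapping.single])
qed

text \<open>On a single path this is \<open>M_elementary_boundary\<close>; the passage to regular
  paths commutes with the diagonal map \<open>M\<close>.\<close>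

lemma boundary_M:
  assumes "x \<in> allowed_chains G n"
  shows "path_boundary h (M x) = a *\<^sub>R M (d x)"
proof -
  have "(path_boundary h \<circ> M) x = ((\<lambda>y. a *\<^sub>R y) \<circ> (M \<circ> d)) x"
  proof (rule linear_eq_singles[where f = "path_boundary h \<circ> M" and g = "(\<lambda>y. a *\<^sub>R y) \<circ> (M \<circ> d)"
        and P = "allowed_paths G n"])
    show "linear (path_boundary h \<circ> M)"
      by (rule linear_compose[OF linear_rescale linear_path_boundary])
    show "linear ((\<lambda>y. a *\<^sub>R y) \<circ> (M \<circ> d))"
      by (intro linear_compose linear_rescale linear_path_boundary linear_scaleR)
    show "Poly_Mapping.keys x \<subseteq> allowed_paths G n"
      using assms by (simp add: allowed_chains_iff)
    fix p assume "p \<in> allowed_paths G n"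
    then have p: "set p \<subseteq> pverts G"
      using allowed_pathsD by blast
    have "M (Poly_Mapping.single p 1) = w p *\<^sub>R Poly_Mapping.single p 1"
      by (simp add: rescale_single scaleR_single)
    then have "path_boundary h (M (Poly_Mapping.single p 1)) = regular_part (w p *\<^sub>R elementary_boundary h p)"
      by (simp add: linear_cmul[OF linear_path_boundary] path_boundary_single linear_cmul[OF linear_regular_part])
    also have "\<dots> = a *\<^sub>R M (d (Poly_Mapping.single p 1))"
      by (simp only: M_elementary_boundary[OF p] linear_cmul[OF linear_regular_part] path_boundary_single
          rescale_regular_part)
    finally show "(path_boundary h \<circ> M) (Poly_Mapping.single p 1) = ((\<lambda>y. a *\<^sub>R y) \<circ> (M \<circ> d)) (Poly_Mapping.single p 1)"
      by simp
  qed
  then show ?thesis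
    by simp
qed

lemma allowed_scaleR: "r \<noteq> 0 \<Longrightarrow> r *\<^sub>R x \<in> allowed_chains G n \<longleftrightarrow> x \<in> allowed_chains G n"
  by (auto simp: allowed_chains_iff subset_iff in_keys_iff lookup_scaleR)

text \<open>\<open>M\<close> preserves supports, and by \<open>boundary_M\<close> with
  \<open>a \<noteq> 0\<close> so does passing from \<open>d x\<close> to the weighted boundary of
  \<open>M x\<close>.\<close>

lemma Omega_M: "Omega G h n = M ` \<Omega> n"
proof (intro subset_antisym subsetI)
  fix y assume y: "y \<in> Omega G h n"
  define x where "x = rescale (\<lambda>p. inverse (w p)) y"
  have Mx: "M x = y"
    unfolding x_def by (rule rescale_inverse[OF w_nonzero])
  then have "x \<in> allowed_chains G n"
    using y M_allowed[of x n] by (simp add: Omega_def)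
  then have "x \<in> \<Omega> n"
    using y Mx boundary_M[of x n] by (auto simp: Omega_def allowed_scaleR[OF a_nonzero] M_allowed)
  then show "y \<in> M ` \<Omega> n"
    using Mx by blast
qed (auto simp: Omega_def boundary_M allowed_scaleR[OF a_nonzero] M_allowed)

text \<open>The factors \<open>w p\<close> cancel the product of \<open>f\<close>, leaving one
  \<open>b\<close> for each of the \<open>n + 1\<close> vertices, squared.\<close>

lemma weighted_inner_M:
  assumes x: "x \<in> allowed_chains G n" and y: "y \<in> allowed_chains G n"
  shows "weighted_inner g (M x) (M y) = b ^ (2 * nat (n + 1)) * chain_inner x y"
proof -
  have "(\<Sum>q\<in>Poly_Mapping.keys (M y). Poly_Mapping.lookup (M x) p * Poly_Mapping.lookup (M y) q * elementary_inner g p q)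
      = b ^ (2 * nat (n + 1)) * (Poly_Mapping.lookup x p * Poly_Mapping.lookup y p)"
    if p: "p \<in> Poly_Mapping.keys x" for p
  proof -
    have "p \<in> allowed_paths G n"
      using x p by (auto simp: allowed_chains_iff)
    then have pn: "set p \<subseteq> pverts G" "length p = nat (n + 1)"
      using allowed_pathsD[of p G n] by (simp_all, linarith)
    have gp: "prod_list (map g p) = b ^ length p * prod_list (map f p)"
      using pn(1) by (induction p) (simp_all add: g)
    have wp: "w p * prod_list (map f p) = 1"
      using w_nonzero[of p] by simp
    have "(\<Sum>q\<in>Poly_Mapping.keys (M y). Poly_Mapping.lookup (M x) p * Poly_Mapping.lookup (M y) q * elementary_inner g p q)
        = (\<Sum>q\<in>Poly_Mapping.keys (M y). if p = q then
            Poly_Mapping.lookup (M x) p * Poly_Mapping.lookup (M y) p * (prod_list (map g p))\<^sup>2 else 0)"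
    proof (rule sum.cong[OF refl])
      fix q assume "q \<in> Poly_Mapping.keys (M y)"
      then have "q \<in> allowed_paths G n"
        using y by (auto simp: allowed_chains_iff keys_rescale[OF w_nonzero])
      then have "length q = nat (n + 1)"
        using allowed_pathsD[of q G n] by (simp, linarith)
      then show "Poly_Mapping.lookup (M x) p * Poly_Mapping.lookup (M y) q * elementary_inner g p q =
          (if p = q then Poly_Mapping.lookup (M x) p * Poly_Mapping.lookup (M y) p * (prod_list (map g p))\<^sup>2 else 0)"
        using pn(2) by (simp add: elementary_inner_eq)
    qed
    also have "\<dots> = Poly_Mapping.lookup (M x) p * Poly_Mapping.lookup (M y) p * (prod_list (map g p))\<^sup>2"
      by (simp add: sum.delta in_keys_iff)
    also have "\<dots> = (w p * prod_list (map f p))\<^sup>2 * (b ^ length p)\<^sup>2 * (Poly_Mapping.lookup x p * Poly_Mapping.lookup y p)"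
      unfolding gp lookup_rescale power2_eq_square by (simp only: mult_ac)
    also have "\<dots> = b ^ (2 * nat (n + 1)) * (Poly_Mapping.lookup x p * Poly_Mapping.lookup y p)"
      unfolding wp by (simp add: pn(2) power_mult[symmetric] mult.commute)
    finally show ?thesis .
  qed
  then show ?thesis
    unfolding weighted_inner_def chain_inner_def by (simp add: keys_rescale[OF w_nonzero] sum_distrib_left)
qed

lemma \<Omega>_allowed: "x \<in> \<Omega> n \<Longrightarrow> x \<in> allowed_chains G n" "x \<in> \<Omega> n \<Longrightarrow> d x \<in> allowed_chains G (n - 1)"
  by (simp_all add: Omega_def)

text \<open>The boundary contributes \<open>a\<close>. The inner products in degrees
  \<open>n - 1\<close> and \<open>n\<close> differ by the factor \<open>b\<^sup>2\<close>, which the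
  adjoint divides out.\<close>

lemma boundary_adjoint_M:
  assumes n: "n \<ge> 0" and y: "y \<in> \<Omega> (n - 1)"
  shows "boundary_adjoint G h g n (M y) = (a / b\<^sup>2) *\<^sub>R M (adj n y)"
proof -
  have S: "subspace (\<Omega> n)"
    by (rule fin_subspace_subspace[OF fin_\<Omega>])
  have bn: "b ^ (2 * nat (n + 1)) = b\<^sup>2 * b ^ (2 * nat n)"
    using n by (simp add: nat_add_distrib power_add power2_eq_square)
  have left: "weighted_inner g (path_boundary h (M u)) (M y) = a * b ^ (2 * nat n) * chain_inner (d u) y"
    if "u \<in> \<Omega> n" for u
    using weighted_inner_M[of "a *\<^sub>R d u" "n - 1" y] \<Omega>_allowed[OF that] \<Omega>_allowed(1)[OF y]
    by (simp add: boundary_M[OF \<Omega>_allowed(1)[OF that]] allowed_scaleR[OF a_nonzero] chain.scale_left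
        linear_cmul[OF linear_rescale])
  have right: "weighted_inner g (M u) (M x) = b\<^sup>2 * b ^ (2 * nat n) * chain_inner u x"
    if "u \<in> \<Omega> n" "x \<in> \<Omega> n" for u x
    using weighted_inner_M[OF \<Omega>_allowed(1)[OF that(1)] \<Omega>_allowed(1)[OF that(2)]] bn by simp
  \<comment> \<open>Every candidate for the weighted adjoint has the form \<open>M x\<close>, so
    this equivalence gives both existence and uniqueness in the description.\<close>
  have iff: "(\<forall>u\<in>Omega G h n. weighted_inner g (path_boundary h u) (M y) = weighted_inner g u (M x)) \<longleftrightarrow>
      x = (a / b\<^sup>2) *\<^sub>R adj n y" if x: "x \<in> \<Omega> n" for x
  proof -
    have "weighted_inner g (path_boundary h (M u)) (M y) = weighted_inner g (M u) (M x) \<longleftrightarrow>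
        chain_inner u ((a / b\<^sup>2) *\<^sub>R adj n y) = chain_inner u x" if u: "u \<in> \<Omega> n" for u
      unfolding left[OF u] right[OF u x] adj(2)[OF u] chain.scale_right
      using b_nonzero by (simp add: field_simps)
    then have "(\<forall>u\<in>Omega G h n. weighted_inner g (path_boundary h u) (M y) = weighted_inner g u (M x)) \<longleftrightarrow>
        (\<forall>u\<in>\<Omega> n. chain_inner u ((a / b\<^sup>2) *\<^sub>R adj n y) = chain_inner u x)"
      by (simp add: Omega_M)
    also have "\<dots> \<longleftrightarrow> x = (a / b\<^sup>2) *\<^sub>R adj n y"
      using chain.eqI[OF S x subspace_scale[OF S adj(1)]] by metis
    finally show ?thesis .
  qed
  show ?thesis
    unfolding boundary_adjoint_def
  proof (rule the_equality)
    have "(a / b\<^sup>2) *\<^sub>R adj n y \<in> \<Omega> n"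
      by (rule subspace_scale[OF S adj(1)])
    then show "(a / b\<^sup>2) *\<^sub>R M (adj n y) \<in> Omega G h n \<and>
        (\<forall>u\<in>Omega G h n. weighted_inner g (path_boundary h u) (M y) = weighted_inner g u ((a / b\<^sup>2) *\<^sub>R M (adj n y)))"
      using iff[of "(a / b\<^sup>2) *\<^sub>R adj n y"] by (simp add: Omega_M linear_cmul[OF linear_rescale, symmetric])
    fix z assume z: "z \<in> Omega G h n \<and>
        (\<forall>u\<in>Omega G h n. weighted_inner g (path_boundary h u) (M y) = weighted_inner g u z)"
    then obtain x where "x \<in> \<Omega> n" "z = M x"
      by (auto simp: Omega_M)
    then show "z = (a / b\<^sup>2) *\<^sub>R M (adj n y)"
      using iff[of x] z by (simp add: linear_cmul[OF linear_rescale])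
  qed
qed

text \<open>Each of the two terms contains one boundary, with factor \<open>a\<close>, and one
  adjoint, with factor \<open>a / b\<^sup>2\<close>.\<close>

lemma Laplacian_M:
  assumes "n \<ge> 0" "x \<in> \<Omega> n"
  shows "path_Laplacian G h g n (M x) = (a\<^sup>2 / b\<^sup>2) *\<^sub>R M (L n x)"
proof -
  have "a *\<^sub>R d x \<in> \<Omega> (n - 1)"
    using subspace_scale[OF fin_subspace_subspace[OF fin_\<Omega>] path_boundary_Omega[OF assms(2)]] .
  then have "boundary_adjoint G h g n (path_boundary h (M x)) = (a / b\<^sup>2) *\<^sub>R M (a *\<^sub>R adj n (d x))"
    using boundary_adjoint_M[OF assms(1), of "a *\<^sub>R d x"] boundary_M[OF \<Omega>_allowed(1)[OF assms(2)]]
    by (simp add: chain.adjoint_on_scale[OF fin_\<Omega> linear_path_boundary] linear_cmul[OF linear_rescale])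
  moreover have "boundary_adjoint G h g (n + 1) (M x) = (a / b\<^sup>2) *\<^sub>R M (adj (n + 1) x)"
    using boundary_adjoint_M[of "n + 1" x] assms by simp
  moreover have "path_boundary h (M (adj (n + 1) x)) = a *\<^sub>R M (d (adj (n + 1) x))"
    by (rule boundary_M[OF \<Omega>_allowed(1)[OF adj(1)]])
  ultimately show ?thesis
    by (simp add: path_Laplacian_def L_def linear_add[OF linear_rescale] linear_cmul[OF linear_rescale]
        linear_cmul[OF linear_path_boundary] scaleR_add_right power2_eq_square)
qed

lemma ratio_pos: "a\<^sup>2 / b\<^sup>2 > 0"
  using a_nonzero b_nonzero by simp

lemma Laplacian_eigenspace_M:
  assumes "n \<ge> 0"
  shows "Laplacian_eigenspace G h g n (\<nu> * (a\<^sup>2 / b\<^sup>2)) = M ` E n \<nu>"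
proof -
  have "path_Laplacian G h g n (M x) = (\<nu> * (a\<^sup>2 / b\<^sup>2)) *\<^sub>R M x \<longleftrightarrow> L n x = \<nu> *\<^sub>R x" if "x \<in> \<Omega> n" for x
  proof -
    have "(\<nu> * (a\<^sup>2 / b\<^sup>2)) *\<^sub>R M x = (a\<^sup>2 / b\<^sup>2) *\<^sub>R M (\<nu> *\<^sub>R x)"
      by (simp add: linear_cmul[OF linear_rescale] mult.commute)
    then have "path_Laplacian G h g n (M x) = (\<nu> * (a\<^sup>2 / b\<^sup>2)) *\<^sub>R M x \<longleftrightarrow> M (L n x) = M (\<nu> *\<^sub>R x)"
      using Laplacian_M[OF assms that] a_nonzero b_nonzero by simp
    then show ?thesis
      using inj_eq[OF inj_rescale[of w, OF w_nonzero]] by simp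
  qed
  then show ?thesis
    unfolding Laplacian_eigenspace_def chain.eigenspace_def Omega_M by blast
qed

section \<open>Zeta functions and torsion\<close>

definition ev :: "int \<Rightarrow> real set" where
  "ev n = {\<nu>. \<nu> > 0 \<and> E n \<nu> \<noteq> {0}}"

lemma sum_dim_ev: "(\<Sum>\<nu>\<in>ev n. dim (E n \<nu>)) = dim (d ` \<Omega> n) + dim (d ` \<Omega> (n + 1))"
proof -
  have "d ` \<Omega> (n + 1) \<subseteq> \<Omega> n"
    using path_boundary_Omega[of _ G _ "n + 1"] by auto
  then show ?thesis
    unfolding ev_def
    by (intro chain.sum_dim_positive_eigenspaces[OF fin_\<Omega> fin_\<Omega> linear_path_boundary linear_path_boundary _
          path_boundary_path_boundary L_def])
qed

text \<open>The positive factor \<open>a\<^sup>2 / b\<^sup>2\<close> maps the positive unweighted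
  eigenvalues bijectively to the weighted ones, and the injective map \<open>M\<close> keeps
  multiplicities.\<close>

lemma path_zeta_eq:
  assumes "n \<ge> 0"
  shows "path_zeta G h g n s = (\<Sum>\<nu>\<in>ev n. real (dim (E n \<nu>)) * (\<nu> * (a\<^sup>2 / b\<^sup>2)) powr (- s))"
proof -
  let ?r = "a\<^sup>2 / b\<^sup>2"
  have inj: "inj M"
    by (rule inj_rescale[OF w_nonzero])
  have dim: "dim (Laplacian_eigenspace G h g n (\<nu> * ?r)) = dim (E n \<nu>)" for \<nu>
    using inj unfolding Laplacian_eigenspace_M[OF assms]
    by (intro dim_image_inj_on linear_rescale) (rule inj_on_subset, auto)
  have nontriv: "Laplacian_eigenspace G h g n (\<nu> * ?r) \<noteq> {0} \<longleftrightarrow> E n \<nu> \<noteq> {0}" for \<nu>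
    unfolding Laplacian_eigenspace_M[OF assms]
    using inj_image_eq_iff[OF inj, of "E n \<nu>" "{0}"] by (simp add: linear_0[OF linear_rescale])
  have "{\<mu>. \<mu> > 0 \<and> Laplacian_eigenspace G h g n \<mu> \<noteq> {0}} = (\<lambda>\<nu>. \<nu> * ?r) ` ev n"
  proof (intro subset_antisym subsetI)
    fix \<mu> assume \<mu>: "\<mu> \<in> {\<mu>. \<mu> > 0 \<and> Laplacian_eigenspace G h g n \<mu> \<noteq> {0}}"
    then have "\<mu> / ?r \<in> ev n"
      using nontriv[of "\<mu> / ?r"] ratio_pos a_nonzero b_nonzero
      by (simp add: ev_def)
    then show "\<mu> \<in> (\<lambda>\<nu>. \<nu> * ?r) ` ev n"
      using a_nonzero b_nonzero by (intro image_eqI[of _ _ "\<mu> / ?r"]) auto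
  qed (use nontriv ratio_pos in \<open>auto simp: ev_def simp del: times_divide_eq_right intro!: mult_pos_pos\<close>)
  moreover have "inj_on (\<lambda>\<nu>. \<nu> * ?r) (ev n)"
    using ratio_pos by (auto simp: inj_on_def)
  ultimately show ?thesis
    unfolding path_zeta_def by (simp add: sum.reindex dim del: times_divide_eq_right)
qed

text \<open>The rank of the boundary out of degree \<open>n\<close>, not a Betti number.\<close>

definition \<beta> :: "nat \<Rightarrow> real" where
  "\<beta> n = real (dim (d ` \<Omega> (int n)))"

text \<open>The derivative at 0 of the unweighted zeta function.\<close>

definition D :: "nat \<Rightarrow> real" where
  "D n = (\<Sum>\<nu>\<in>ev (int n). real (dim (E (int n) \<nu>)) * (- ln \<nu>))"

text \<open>The logarithm of a scaled eigenvalue splits, and its constant part is multiplied by the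
  total multiplicity, which \<open>sum_dim_ev\<close> expresses through ranks.\<close>

lemma deriv_path_zeta:
  "deriv (path_zeta G h g (int n)) 0 = D n - ln (a\<^sup>2 / b\<^sup>2) * (\<beta> n + \<beta> (n + 1))"
proof -
  let ?r = "a\<^sup>2 / b\<^sup>2"
  have "((\<lambda>s. \<Sum>\<nu>\<in>ev n. real (dim (E n \<nu>)) * (\<nu> * ?r) powr (- s)) has_real_derivative
      (\<Sum>\<nu>\<in>ev n. real (dim (E n \<nu>)) * (- ln (\<nu> * ?r)))) (at 0)"
  proof (rule DERIV_sum)
    fix \<nu> assume "\<nu> \<in> ev n"
    then have "\<nu> * ?r > 0"
      using ratio_pos by (intro mult_pos_pos) (auto simp: ev_def)
    then have "((\<lambda>s. (\<nu> * ?r) powr (- s)) has_real_derivative - ln (\<nu> * ?r)) (at 0)"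
      by (auto intro!: derivative_eq_intros)
    then show "((\<lambda>s. real (dim (E n \<nu>)) * (\<nu> * ?r) powr (- s)) has_real_derivative
        real (dim (E n \<nu>)) * (- ln (\<nu> * ?r))) (at 0)"
      by (rule DERIV_cmult)
  qed
  moreover have "path_zeta G h g (int n) = (\<lambda>s. \<Sum>\<nu>\<in>ev n. real (dim (E n \<nu>)) * (\<nu> * ?r) powr (- s))"
    by (intro ext path_zeta_eq) simp
  ultimately have "deriv (path_zeta G h g (int n)) 0 = (\<Sum>\<nu>\<in>ev n. real (dim (E n \<nu>)) * (- ln (\<nu> * ?r)))"
    by (simp add: DERIV_imp_deriv)
  also have "\<dots> = (\<Sum>\<nu>\<in>ev n. real (dim (E n \<nu>)) * (- ln \<nu>) - ln ?r * real (dim (E n \<nu>)))"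
  proof (rule sum.cong[OF refl])
    fix \<nu> assume "\<nu> \<in> ev n"
    then have "ln (\<nu> * ?r) = ln \<nu> + ln ?r"
      using ratio_pos by (intro ln_mult_pos) (auto simp: ev_def)
    then show "real (dim (E n \<nu>)) * (- ln (\<nu> * ?r)) = real (dim (E n \<nu>)) * (- ln \<nu>) - ln ?r * real (dim (E n \<nu>))"
      by (simp add: algebra_simps)
  qed
  also have "\<dots> = D n - ln ?r * real (\<Sum>\<nu>\<in>ev n. dim (E n \<nu>))"
    by (simp add: D_def sum_subtractf sum_distrib_left)
  finally show ?thesis
    by (simp add: sum_dim_ev \<beta>_def add.commute)
qed

theorem torsion_eq:
  assumes "\<And>n::int. n \<ge> int N + 1 \<Longrightarrow> \<Omega> n = {0}"
  shows "torsion G N h g = (\<bar>b\<bar> / \<bar>a\<bar>) powi torsion_exponent G * exp (1 / 2 * (\<Sum>n = 0..N. (-1) ^ n * real n * D n))"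
proof -
  have zero: "\<beta> n = 0" if "n > N" for n
    using assms[of "int n"] that by (simp add: \<beta>_def linear_0[OF linear_path_boundary] dim_zero)
  \<comment> \<open>The boundary is 0 in degree 0 by convention, which removes the term
    \<open>\<beta> 0\<close> left by telescoping.\<close>
  have "d x = 0" if "x \<in> \<Omega> 0" for x
  proof (rule linear_eq_singles[OF linear_path_boundary linear_zero, where P = "allowed_paths G 0"])
    show "Poly_Mapping.keys x \<subseteq> allowed_paths G 0"
      using that by (simp add: Omega_def allowed_chains_iff)
    fix p assume "p \<in> allowed_paths G 0"
    then have "length p = 1"
      using allowed_pathsD by fastforce
    then show "d (Poly_Mapping.single p 1) = 0"
      by (simp add: path_boundary_single elementary_boundary_def linear_0[OF linear_regular_part])
  qed
  moreover have "0 \<in> \<Omega> 0"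
    by (rule subspace_0[OF fin_subspace_subspace[OF fin_\<Omega>]])
  ultimately have "d ` \<Omega> 0 = {0}"
    by force
  then have \<beta>0: "\<beta> 0 = 0"
    by (simp add: \<beta>_def dim_zero)
  have "torsion_exponent G = (\<Sum>n = 0..N. (-1) ^ n * int (dim (d ` \<Omega> (int n))))"
    unfolding torsion_exponent_def
    by (rule Sum_any.expand_superset) (use zero in \<open>auto simp: \<beta>_def not_less[symmetric]\<close>)
  then have s: "real_of_int (torsion_exponent G) = (\<Sum>n = 0..N. (-1) ^ n * \<beta> n)"
    by (simp add: \<beta>_def)
  have "(\<Sum>n = 0..N. (-1) ^ n * real n * deriv (path_zeta G h g (int n)) 0) =
      (\<Sum>n = 0..N. (-1) ^ n * real n * D n) - ln (a\<^sup>2 / b\<^sup>2) * (\<Sum>n = 0..N. (-1) ^ n * real n * (\<beta> n + \<beta> (n + 1)))"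
    unfolding deriv_path_zeta sum_distrib_left sum_subtractf[symmetric]
    by (intro sum.cong refl) (simp add: algebra_simps)
  also have "(\<Sum>n = 0..N. (-1) ^ n * real n * (\<beta> n + \<beta> (n + 1))) = real_of_int (torsion_exponent G)"
    using sum_alternating_telescope[of \<beta> N] zero[of "N + 1"] \<beta>0 s by simp
  \<comment> \<open>The factor \<open>-2\<close> cancels the \<open>1 / 2\<close> and the sign in
    the logarithm of the torsion.\<close>
  also have "ln (a\<^sup>2 / b\<^sup>2) = - 2 * ln (\<bar>b\<bar> / \<bar>a\<bar>)"
  proof -
    have "ln (a\<^sup>2 / b\<^sup>2) = ln ((\<bar>a\<bar> / \<bar>b\<bar>) ^ 2)"
      by (simp add: power_divide)
    also have "\<dots> = 2 * ln (\<bar>a\<bar> / \<bar>b\<bar>)"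
      using a_nonzero b_nonzero by (subst ln_realpow) auto
    finally show ?thesis
      using a_nonzero b_nonzero by (simp add: ln_div)
  qed
  finally have "torsion G N h g = exp (real_of_int (torsion_exponent G) * ln (\<bar>b\<bar> / \<bar>a\<bar>) +
      1 / 2 * (\<Sum>n = 0..N. (-1) ^ n * real n * D n))"
    unfolding torsion_def by (simp add: algebra_simps)
  also have "exp (real_of_int (torsion_exponent G) * ln (\<bar>b\<bar> / \<bar>a\<bar>)) = (\<bar>b\<bar> / \<bar>a\<bar>) powi torsion_exponent G"
    using a_nonzero b_nonzero by (simp add: powr_real_of_int'[symmetric] powr_def)
  ultimately show ?thesis
    by (simp add: exp_add)
qed

end

lemma torsion_scaled_weights:
  fixes G :: "'a pair_pre_digraph" and N :: nat
  assumes G: "pair_digraph G"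
    and N: "\<And>n::int. n \<ge> int N + 1 \<Longrightarrow> Omega G (\<lambda>_. 1) n = {0}"
    and f: "\<And>v. v \<in> pverts G \<Longrightarrow> f v \<noteq> 0"
    and "a \<noteq> 0" "b \<noteq> 0"
  shows "torsion G N (\<lambda>v. a * f v) (\<lambda>v. b * f v) =
    (\<bar>b\<bar> / \<bar>a\<bar>) powi torsion_exponent G * torsion G N (\<lambda>_. 1) (\<lambda>_. 1)"
proof -
  \<comment> \<open>Only the values of \<open>f\<close> on vertices are known to be nonzero; the
    default 1 elsewhere meets the locale assumption without changing anything on the
    digraph.\<close>
  define f' where "f' v = (if v \<in> pverts G then f v else 1)" for v
  interpret S: scaled_weights G f' "\<lambda>v. a * f v" "\<lambda>v. b * f v" a b
    by (rule scaled_weights.intro) (use assms in \<open>simp_all add: f'_def\<close>)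
  interpret U: scaled_weights G "\<lambda>_. 1" "\<lambda>_. 1" "\<lambda>_. 1" 1 1
    by (rule scaled_weights.intro) (use G in simp_all)
  \<comment> \<open>Both are computed from the unweighted Laplacian of \<open>G\<close>, so the
    exponential factor in \<open>torsion_eq\<close> is common to the two torsions.\<close>
  have "S.D = U.D"
    unfolding S.D_def U.D_def S.ev_def U.ev_def S.L_def U.L_def ..
  then show ?thesis
    using S.torsion_eq[OF N] U.torsion_eq[OF N] by simp
qed

theorem corollary1p2:
  fixes G :: "'a pair_pre_digraph" and N :: nat and f :: "'a \<Rightarrow> real" and c :: real
  assumes "pair_digraph G"
    and "N > 0"
    and "\<And>n::int. n \<ge> int N + 1 \<Longrightarrow> Omega G (\<lambda>_. 1) n = {0}"
    and "\<And>v. v \<in> pverts G \<Longrightarrow> f v \<noteq> 0"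
    and "c \<noteq> 0"
  shows "torsion G N (\<lambda>_. 1) (\<lambda>_. 1) = torsion G N f f \<and>
    torsion G N f f = torsion_factor G c * torsion G N (\<lambda>v. c * f v) f \<and>
    torsion_factor G c * torsion G N (\<lambda>v. c * f v) f =
      inverse (torsion_factor G c) * torsion G N f (\<lambda>v. c * f v)"
proof -
  note T = torsion_scaled_weights[OF assms(1,3,4)]
  have "torsion G N f f = torsion G N (\<lambda>_. 1) (\<lambda>_. 1)"
    using T[where a = 1 and b = 1] by simp
  moreover have "torsion G N (\<lambda>v. c * f v) f = inverse (torsion_factor G c) * torsion G N (\<lambda>_. 1) (\<lambda>_. 1)"
    using T[where a = c and b = 1] assms(5) by (simp add: torsion_factor_def power_int_inverse divide_inverse)
  moreover have "torsion G N f (\<lambda>v. c * f v) = torsion_factor G c * torsion G N (\<lambda>_. 1) (\<lambda>_. 1)"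
    using T[where a = 1 and b = c] assms(5) by (simp add: torsion_factor_def)
  moreover have "torsion_factor G c \<noteq> 0"
    using assms(5) by (simp add: torsion_factor_def)
  ultimately show ?thesis
    by simp
qed

end
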